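(* Let $\mathcal A$ be an essentially small idempotent-complete exact category with enough projective objects. Let $\mathcal X\subseteq\mathcal A$ be a full resolving subcategory, equipped with the exact structure restricted from $\mathcal A$. Assume that the inclusion identifies the full subcategory $\operatorname{Proj}\mathcal X$ with $\operatorname{Proj}\mathcal A\subseteq\mathcal X$, and that for some integer $c\ge0$, $$\Omega_{\mathcal A}^cM\in\mathcal X\qquad\text{for every }M\in\mathcal A .$$ Then, for every $X\in\mathcal X$ and every $k\ge1$, $$k\text{-}\operatorname{ddell}_{\mathcal A}X\le k\text{-}\operatorname{ddell}_{\mathcal X}X\le c+(k+c)\text{-}\operatorname{ddell}_{\mathcal A}X .$$
   Context: A full subcategory of an exact category is resolving if it contains the projective objects and is closed under extensions, direct summands and kernels of deflations between its objects. For an exact category $\mathcal E$ with enough projectives (applied to $\mathcal E=\mathcal A$ and $\mathcal E=\mathcal X$): short exact sequences of the exact structure are called conflations. For each $X\in\mathcal E$ fix a conflation $0\to\Omega_{\mathcal E}X\to P_X\to X\to0$ with $P_X$ projective. The stable category $\underline{\mathcal E}=\mathcal E/[\operatorname{Proj}\mathcal E]$ has morphisms modulo those factoring through projectives, and $\Omega_{\mathcal E}$ is an endofunctor of it. $X$ is a stable retract of $Y$ if there are $u:X\to Y$, $v:Y\to X$ in $\underline{\mathcal E}$ with $vu=1_X$. For $k\ge1$, $$k\text{-}\operatorname{dell}_{\mathcal E}X=\inf\{n\ge0\mid \Omega_{\mathcal E}^nX\text{ is a stable retract of }\Omega_{\mathcal E}^{n+k}Y\text{ for some }Y\in\mathcal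 E\}.$$ A sequence $0\to C_t\to\cdots\to C_0\to X\to0$ is admissibly exact if there are objects $Z_0=X,Z_1,\dots,Z_t=C_t$ and conflations $0\to Z_{i+1}\to C_i\to Z_i\to0$ for $0\le i<t$ from which it is spliced (for $t=0$: $C_0\to X$ is an isomorphism). $k\text{-}\operatorname{ddell}_{\mathcal E}X$ is the infimum of the integers $m\ge0$ such that there are $0\le t\le m$ and an admissibly exact sequence $0\to C_t\to\cdots\to C_0\to X\to0$ with $(i+k)\text{-}\operatorname{dell}_{\mathcal E}C_i\le m-i$ for $0\le i\le t$. ($\inf\emptyset=\infty$.) *)

theory Defs
  imports "HOL-Algebra.Group" "HOL-Library.Extended_Nat"
begin

section \<open>Categories\<close>

text \<open>
  Objects and arrows are elements of HOL types, so the categories below are automatically small.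
  Essential smallness is therefore not a separate hypothesis: an essentially small category is
  one that is equivalent to such a category.
\<close>

record ('o, 'm) cat_data =
  Obj :: "'o set"
  Arr :: "'m set"
  Dom :: "'m \<Rightarrow> 'o"
  Cod :: "'m \<Rightarrow> 'o"
  Ident :: "'o \<Rightarrow> 'm"
  Cmp :: "'m \<Rightarrow> 'm \<Rightarrow> 'm"  (infixr "\<cdot>\<index>" 75)

definition Mor :: "('o, 'm, 'z) cat_data_scheme \<Rightarrow> 'o \<Rightarrow> 'o \<Rightarrow> 'm set" where
  "Mor C X Y = {f \<in> Arr C. Dom C f = X \<and> Cod C f = Y}"

locale category =
  fixes C :: "('o, 'm, 'z) cat_data_scheme" (structure)
  assumes Dom_Obj: "f \<in> Arr C \<Longrightarrow> Dom C f \<in> Obj C"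
    and Cod_Obj: "f \<in> Arr C \<Longrightarrow> Cod C f \<in> Obj C"
    and Ident_Mor: "X \<in> Obj C \<Longrightarrow> Ident C X \<in> Mor C X X"
    and Cmp_Mor: "f \<in> Mor C X Y \<Longrightarrow> g \<in> Mor C Y Z \<Longrightarrow> g \<cdot> f \<in> Mor C X Z"
    and Cmp_Ident_left: "f \<in> Mor C X Y \<Longrightarrow> Ident C Y \<cdot> f = f"
    and Cmp_Ident_right: "f \<in> Mor C X Y \<Longrightarrow> f \<cdot> Ident C X = f"
    and Cmp_assoc: "f \<in> Mor C X Y \<Longrightarrow> g \<in> Mor C Y Z \<Longrightarrow> h \<in> Mor C Z W \<Longrightarrow>
      (h \<cdot> g) \<cdot> f = h \<cdot> (g \<cdot> f)"

definition isomorphism :: "('o, 'm, 'z) cat_data_scheme \<Rightarrow> 'm \<Rightarrow> bool" where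
  "isomorphism C f \<longleftrightarrow> f \<in> Arr C \<and>
     (\<exists>g \<in> Mor C (Cod C f) (Dom C f).
        g \<cdot>\<^bsub>C\<^esub> f = Ident C (Dom C f) \<and> f \<cdot>\<^bsub>C\<^esub> g = Ident C (Cod C f))"

definition retract :: "('o, 'm, 'z) cat_data_scheme \<Rightarrow> 'o \<Rightarrow> 'o \<Rightarrow> bool" where
  "retract C X Y \<longleftrightarrow> (\<exists>u \<in> Mor C X Y. \<exists>v \<in> Mor C Y X. v \<cdot>\<^bsub>C\<^esub> u = Ident C X)"

definition idempotent_complete :: "('o, 'm, 'z) cat_data_scheme \<Rightarrow> bool" where
  "idempotent_complete C \<longleftrightarrow>
     (\<forall>X \<in> Obj C. \<forall>e \<in> Mor C X X. e \<cdot>\<^bsub>C\<^esub> e = e \<longrightarrow>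
        (\<exists>Y \<in> Obj C. \<exists>r \<in> Mor C X Y. \<exists>s \<in> Mor C Y X.
           s \<cdot>\<^bsub>C\<^esub> r = e \<and> r \<cdot>\<^bsub>C\<^esub> s = Ident C Y))"

definition zero_object :: "('o, 'm, 'z) cat_data_scheme \<Rightarrow> 'o \<Rightarrow> bool" where
  "zero_object C Z \<longleftrightarrow> Z \<in> Obj C \<and>
     (\<forall>X \<in> Obj C. (\<exists>!f. f \<in> Mor C X Z) \<and> (\<exists>!f. f \<in> Mor C Z X))"

text \<open>In \<open>is_pushout C f g f' g'\<close>, \<open>f'\<close> is the pushout of \<open>f\<close> along \<open>g\<close>, so the
  commuting square is \<open>g' f = f' g\<close>; in \<open>is_pullback\<close> it is \<open>f g' = g f'\<close>.\<close>

definition is_pushout ::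
  "('o, 'm, 'z) cat_data_scheme \<Rightarrow> 'm \<Rightarrow> 'm \<Rightarrow> 'm \<Rightarrow> 'm \<Rightarrow> bool" where
  "is_pushout C f g f' g' \<longleftrightarrow>
     (\<exists>X Y Z W. f \<in> Mor C X Y \<and> g \<in> Mor C X Z \<and> f' \<in> Mor C Z W \<and> g' \<in> Mor C Y W \<and>
        g' \<cdot>\<^bsub>C\<^esub> f = f' \<cdot>\<^bsub>C\<^esub> g \<and>
        (\<forall>T. \<forall>u \<in> Mor C Y T. \<forall>v \<in> Mor C Z T. u \<cdot>\<^bsub>C\<^esub> f = v \<cdot>\<^bsub>C\<^esub> g \<longrightarrow>
           (\<exists>!w. w \<in> Mor C W T \<and> w \<cdot>\<^bsub>C\<^esub> g' = u \<and> w \<cdot>\<^bsub>C\<^esub> f' = v)))"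

definition is_pullback ::
  "('o, 'm, 'z) cat_data_scheme \<Rightarrow> 'm \<Rightarrow> 'm \<Rightarrow> 'm \<Rightarrow> 'm \<Rightarrow> bool" where
  "is_pullback C f g f' g' \<longleftrightarrow>
     (\<exists>X Y Z W. f \<in> Mor C Y X \<and> g \<in> Mor C Z X \<and> f' \<in> Mor C W Z \<and> g' \<in> Mor C W Y \<and>
        f \<cdot>\<^bsub>C\<^esub> g' = g \<cdot>\<^bsub>C\<^esub> f' \<and>
        (\<forall>T. \<forall>u \<in> Mor C T Y. \<forall>v \<in> Mor C T Z. f \<cdot>\<^bsub>C\<^esub> u = g \<cdot>\<^bsub>C\<^esub> v \<longrightarrow>
           (\<exists>!w. w \<in> Mor C T W \<and> g' \<cdot>\<^bsub>C\<^esub> w = u \<and> f' \<cdot>\<^bsub>C\<^esub> w = v)))"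


section \<open>Additive categories\<close>

record ('o, 'm) additive_data = "('o, 'm) cat_data" +
  Add :: "'m \<Rightarrow> 'm \<Rightarrow> 'm"
  Zero :: "'o \<Rightarrow> 'o \<Rightarrow> 'm"

text \<open>The additive group of a hom-set, as a (multiplicatively written) HOL-Algebra group.\<close>

definition hom_group :: "('o, 'm, 'z) additive_data_scheme \<Rightarrow> 'o \<Rightarrow> 'o \<Rightarrow> 'm monoid" where
  "hom_group C X Y = \<lparr>carrier = Mor C X Y, monoid.mult = Add C, one = Zero C X Y\<rparr>"

locale preadditive_category = category C
  for C :: "('o, 'm, 'z) additive_data_scheme" (structure) +
  assumes hom_comm_group: "X \<in> Obj C \<Longrightarrow> Y \<in> Obj C \<Longrightarrow> comm_group (hom_group C X Y)"
    and Cmp_Add_left: "f \<in> Mor C X Y \<Longrightarrow> g \<in> Mor C Y Z \<Longrightarrow> g' \<in> Mor C Y Z \<Longrightarrow>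
      Add C g g' \<cdot> f = Add C (g \<cdot> f) (g' \<cdot> f)"
    and Cmp_Add_right: "f \<in> Mor C X Y \<Longrightarrow> f' \<in> Mor C X Y \<Longrightarrow> g \<in> Mor C Y Z \<Longrightarrow>
      g \<cdot> Add C f f' = Add C (g \<cdot> f) (g \<cdot> f')"

definition is_biproduct :: "('o, 'm, 'z) additive_data_scheme \<Rightarrow> 'o \<Rightarrow> 'o \<Rightarrow> 'o \<Rightarrow> bool" where
  "is_biproduct C S X Y \<longleftrightarrow>
     (\<exists>i1 \<in> Mor C X S. \<exists>i2 \<in> Mor C Y S. \<exists>p1 \<in> Mor C S X. \<exists>p2 \<in> Mor C S Y.
        p1 \<cdot>\<^bsub>C\<^esub> i1 = Ident C X \<and> p2 \<cdot>\<^bsub>C\<^esub> i2 = Ident C Y \<and>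
        p1 \<cdot>\<^bsub>C\<^esub> i2 = Zero C Y X \<and> p2 \<cdot>\<^bsub>C\<^esub> i1 = Zero C X Y \<and>
        Add C (i1 \<cdot>\<^bsub>C\<^esub> p1) (i2 \<cdot>\<^bsub>C\<^esub> p2) = Ident C S)"

locale additive_category = preadditive_category C
  for C :: "('o, 'm, 'z) additive_data_scheme" (structure) +
  assumes ex_zero_object: "\<exists>Z. zero_object C Z"
    and ex_biproduct: "X \<in> Obj C \<Longrightarrow> Y \<in> Obj C \<Longrightarrow> \<exists>S \<in> Obj C. is_biproduct C S X Y"

definition direct_summand :: "('o, 'm, 'z) additive_data_scheme \<Rightarrow> 'o \<Rightarrow> 'o \<Rightarrow> bool" where
  "direct_summand C X S \<longleftrightarrow>
     X \<in> Obj C \<and> S \<in> Obj C \<and> (\<exists>Y \<in> Obj C. is_biproduct C S X Y)"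

definition is_kernel :: "('o, 'm, 'z) additive_data_scheme \<Rightarrow> 'm \<Rightarrow> 'm \<Rightarrow> bool" where
  "is_kernel C i p \<longleftrightarrow>
     (\<exists>X Y Z. i \<in> Mor C X Y \<and> p \<in> Mor C Y Z \<and> p \<cdot>\<^bsub>C\<^esub> i = Zero C X Z \<and>
        (\<forall>T. \<forall>f \<in> Mor C T Y. p \<cdot>\<^bsub>C\<^esub> f = Zero C T Z \<longrightarrow>
           (\<exists>!g. g \<in> Mor C T X \<and> i \<cdot>\<^bsub>C\<^esub> g = f)))"

definition is_cokernel :: "('o, 'm, 'z) additive_data_scheme \<Rightarrow> 'm \<Rightarrow> 'm \<Rightarrow> bool" where
  "is_cokernel C p i \<longleftrightarrow>
     (\<exists>X Y Z. i \<in> Mor C X Y \<and> p \<in> Mor C Y Z \<and> p \<cdot>\<^bsub>C\<^esub> i = Zero C X Z \<and>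
        (\<forall>T. \<forall>f \<in> Mor C Y T. f \<cdot>\<^bsub>C\<^esub> i = Zero C X T \<longrightarrow>
           (\<exists>!g. g \<in> Mor C Z T \<and> g \<cdot>\<^bsub>C\<^esub> p = f)))"


section \<open>Exact categories\<close>

text \<open>\<open>(i, p) \<in> Confl E\<close> means that \<open>0 \<rightarrow> Dom i \<rightarrow> Cod i \<rightarrow> Cod p \<rightarrow> 0\<close> is a conflation.\<close>

record ('o, 'm) exact_data = "('o, 'm) additive_data" +
  Confl :: "('m \<times> 'm) set"

definition inflation :: "('o, 'm, 'z) exact_data_scheme \<Rightarrow> 'm \<Rightarrow> bool" where
  "inflation E i \<longleftrightarrow> (\<exists>p. (i, p) \<in> Confl E)"

definition deflation :: "('o, 'm, 'z) exact_data_scheme \<Rightarrow> 'm \<Rightarrow> bool" where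
  "deflation E p \<longleftrightarrow> (\<exists>i. (i, p) \<in> Confl E)"

text \<open>Quillen's axioms, in the self-dual form of Buehler's survey.\<close>

locale exact_category = additive_category E
  for E :: "('o, 'm, 'z) exact_data_scheme" (structure) +
  assumes Confl_kernel: "(i, p) \<in> Confl E \<Longrightarrow> is_kernel E i p"
    and Confl_cokernel: "(i, p) \<in> Confl E \<Longrightarrow> is_cokernel E p i"
    and Confl_iso: "(i, p) \<in> Confl E \<Longrightarrow>
      isomorphism E a \<Longrightarrow> a \<in> Mor E (Dom E i) X \<Longrightarrow>
      isomorphism E b \<Longrightarrow> b \<in> Mor E (Cod E i) Y \<Longrightarrow>
      isomorphism E c \<Longrightarrow> c \<in> Mor E (Cod E p) Z \<Longrightarrow>
      i' \<in> Mor E X Y \<Longrightarrow> p' \<in> Mor E Y Z \<Longrightarrow>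
      i' \<cdot> a = b \<cdot> i \<Longrightarrow> p' \<cdot> b = c \<cdot> p \<Longrightarrow> (i', p') \<in> Confl E"
    and inflation_Ident: "X \<in> Obj E \<Longrightarrow> inflation E (Ident E X)"
    and deflation_Ident: "X \<in> Obj E \<Longrightarrow> deflation E (Ident E X)"
    and inflation_Cmp: "inflation E i \<Longrightarrow> inflation E j \<Longrightarrow> Cod E i = Dom E j \<Longrightarrow>
      inflation E (j \<cdot> i)"
    and deflation_Cmp: "deflation E p \<Longrightarrow> deflation E q \<Longrightarrow> Cod E p = Dom E q \<Longrightarrow>
      deflation E (q \<cdot> p)"
    and inflation_pushout: "inflation E i \<Longrightarrow> f \<in> Arr E \<Longrightarrow> Dom E f = Dom E i \<Longrightarrow>
      \<exists>i' f'. is_pushout E i f i' f' \<and> inflation E i'"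
    and deflation_pullback: "deflation E p \<Longrightarrow> f \<in> Arr E \<Longrightarrow> Cod E f = Cod E p \<Longrightarrow>
      \<exists>p' f'. is_pullback E p f p' f' \<and> deflation E p'"

definition Proj :: "('o, 'm, 'z) exact_data_scheme \<Rightarrow> 'o set" where
  "Proj E = {P \<in> Obj E. \<forall>Y Z. \<forall>p \<in> Mor E Y Z. deflation E p \<longrightarrow>
     (\<forall>f \<in> Mor E P Z. \<exists>g \<in> Mor E P Y. p \<cdot>\<^bsub>E\<^esub> g = f)}"

definition enough_projectives :: "('o, 'm, 'z) exact_data_scheme \<Rightarrow> bool" where
  "enough_projectives E \<longleftrightarrow>
     (\<forall>X \<in> Obj E. \<exists>P \<in> Proj E. \<exists>p \<in> Mor E P X. deflation E p)"

definition full_subcategory ::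
  "('o, 'm, 'z) exact_data_scheme \<Rightarrow> 'o set \<Rightarrow> ('o, 'm, 'z) exact_data_scheme" where
  "full_subcategory E S = E
     \<lparr>Obj := S,
      Arr := {f \<in> Arr E. Dom E f \<in> S \<and> Cod E f \<in> S},
      Confl := {(i, p) \<in> Confl E. Dom E i \<in> S \<and> Cod E i \<in> S \<and> Cod E p \<in> S}\<rparr>"

definition resolving :: "('o, 'm, 'z) exact_data_scheme \<Rightarrow> 'o set \<Rightarrow> bool" where
  "resolving E S \<longleftrightarrow> S \<subseteq> Obj E \<and> Proj E \<subseteq> S \<and>
     (\<forall>(i, p) \<in> Confl E. Dom E i \<in> S \<and> Cod E p \<in> S \<longrightarrow> Cod E i \<in> S) \<and>
     (\<forall>X Y. Y \<in> S \<and> direct_summand E X Y \<longrightarrow> X \<in> S) \<and>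
     (\<forall>(i, p) \<in> Confl E. Cod E i \<in> S \<and> Cod E p \<in> S \<longrightarrow> Dom E i \<in> S)"


section \<open>Stable categories and syzygies\<close>

definition proj_ideal :: "('o, 'm, 'z) exact_data_scheme \<Rightarrow> 'o \<Rightarrow> 'o \<Rightarrow> 'm set" where
  "proj_ideal E X Y = {b \<cdot>\<^bsub>E\<^esub> a | a b P. P \<in> Proj E \<and> a \<in> Mor E X P \<and> b \<in> Mor E P Y}"

text \<open>Parallel arrows are identified when their difference factors through a projective object.\<close>

definition stable_rel :: "('o, 'm, 'z) exact_data_scheme \<Rightarrow> ('m \<times> 'm) set" where
  "stable_rel E = {(f, g). \<exists>X Y. f \<in> Mor E X Y \<and> g \<in> Mor E X Y \<and>
     f \<otimes>\<^bsub>hom_group E X Y\<^esub> inv\<^bsub>hom_group E X Y\<^esub> g \<in> proj_ideal E X Y}"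

definition stable_category ::
  "('o, 'm, 'z) exact_data_scheme \<Rightarrow> ('o, 'm set) cat_data" where
  "stable_category E =
     \<lparr>Obj = Obj E,
      Arr = Arr E // stable_rel E,
      Dom = (\<lambda>F. the_elem (Dom E ` F)),
      Cod = (\<lambda>F. the_elem (Cod E ` F)),
      Ident = (\<lambda>X. stable_rel E `` {Ident E X}),
      Cmp = (\<lambda>G F. stable_rel E `` {g \<cdot>\<^bsub>E\<^esub> f | g f. g \<in> G \<and> f \<in> F})\<rparr>"

definition stable_retract :: "('o, 'm, 'z) exact_data_scheme \<Rightarrow> 'o \<Rightarrow> 'o \<Rightarrow> bool" where
  "stable_retract E X Y \<longleftrightarrow> retract (stable_category E) X Y"

text \<open>
  \<open>\<Omega>\<close> is the object part of a choice, for every \<open>X\<close>, of a conflation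
  \<open>0 \<rightarrow> \<Omega> X \<rightarrow> P \<rightarrow> X \<rightarrow> 0\<close> with \<open>P\<close> projective.  The invariants below take the choice as
  an argument.
\<close>

definition syzygy_choice :: "('o, 'm, 'z) exact_data_scheme \<Rightarrow> ('o \<Rightarrow> 'o) \<Rightarrow> bool" where
  "syzygy_choice E \<Omega> \<longleftrightarrow>
     (\<forall>X \<in> Obj E. \<exists>P \<in> Proj E. \<exists>i \<in> Mor E (\<Omega> X) P. \<exists>p \<in> Mor E P X. (i, p) \<in> Confl E)"

text \<open>In \<open>enat\<close>, the infimum of the empty set is \<open>\<infinity>\<close>.\<close>

definition dell ::
  "('o, 'm, 'z) exact_data_scheme \<Rightarrow> ('o \<Rightarrow> 'o) \<Rightarrow> nat \<Rightarrow> 'o \<Rightarrow> enat" where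
  "dell E \<Omega> k X =
     Inf {enat n | n. \<exists>Y \<in> Obj E. stable_retract E ((\<Omega> ^^ n) X) ((\<Omega> ^^ (n + k)) Y)}"

text \<open>
  \<open>admissibly_exact E X t C d\<close>: the sequence \<open>0 \<rightarrow> C t \<rightarrow> \<dots> \<rightarrow> C 0 \<rightarrow> X \<rightarrow> 0\<close> with maps
  \<open>d 0 : C 0 \<rightarrow> X\<close> and \<open>d i : C i \<rightarrow> C (i - 1)\<close> for \<open>0 < i \<le> t\<close> is spliced from conflations
  \<open>0 \<rightarrow> Z (i + 1) \<rightarrow> C i \<rightarrow> Z i \<rightarrow> 0\<close>, with maps \<open>j i\<close> and \<open>q i\<close>.
\<close>

definition admissibly_exact ::
  "('o, 'm, 'z) exact_data_scheme \<Rightarrow> 'o \<Rightarrow> nat \<Rightarrow> (nat \<Rightarrow> 'o) \<Rightarrow> (nat \<Rightarrow> 'm) \<Rightarrow> bool" where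
  "admissibly_exact E X t C d \<longleftrightarrow>
     (if t = 0 then d 0 \<in> Mor E (C 0) X \<and> isomorphism E (d 0)
      else \<exists>Z j q. Z 0 = X \<and> Z t = C t \<and>
        (\<forall>i<t. j i \<in> Mor E (Z (Suc i)) (C i) \<and> q i \<in> Mor E (C i) (Z i) \<and>
           (j i, q i) \<in> Confl E) \<and>
        d 0 = q 0 \<and> (\<forall>i. 0 < i \<and> i < t \<longrightarrow> d i = j (i - 1) \<cdot>\<^bsub>E\<^esub> q i) \<and> d t = j (t - 1))"

definition ddell ::
  "('o, 'm, 'z) exact_data_scheme \<Rightarrow> ('o \<Rightarrow> 'o) \<Rightarrow> nat \<Rightarrow> 'o \<Rightarrow> enat" where
  "ddell E \<Omega> k X =
     Inf {enat m | m. \<exists>t\<le>m. \<exists>C d. admissibly_exact E X t C d \<and>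
       (\<forall>i\<le>t. dell E \<Omega> (i + k) (C i) \<le> enat (m - i))}"

end

theory Submission
  imports Defs
begin

text \<open>
  The lower bound holds because admissible sequences, stable retracts and, up to stable
  isomorphism, syzygies in \<open>\<X>\<close> are the same as in \<open>\<A>\<close>.  For the upper bound, start from a
  sequence \<open>0 \<rightarrow> C\<^sub>t \<rightarrow> \<dots> \<rightarrow> C\<^sub>0 \<rightarrow> X \<rightarrow> 0\<close> in \<open>\<A>\<close>.  Applying a horseshoe lemma \<open>c\<close> times
  gives a sequence \<open>0 \<rightarrow> D\<^sub>t \<rightarrow> \<dots> \<rightarrow> D\<^sub>0 \<rightarrow> \<Omega>\<^sup>c X \<rightarrow> 0\<close> in which each \<open>D\<^sub>i\<close> is a \<open>c\<close>-th syzygy of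
  \<open>C\<^sub>i\<close> and therefore lies in \<open>\<X>\<close>.  Splicing it with a projective resolution of \<open>X\<close> costs \<open>c\<close>
  further steps.  If \<open>\<Omega>\<^sup>n C\<^sub>i\<close> is a stable retract of \<open>\<Omega>\<^bsup>n+i+k+c\<^esup> Y\<close>, then \<open>\<Omega>\<^sup>n D\<^sub>i\<close> is one of
  \<open>\<Omega>\<^bsup>n+i+k+c\<^esup> (\<Omega>\<^sup>c Y)\<close>, and \<open>\<Omega>\<^sup>c Y\<close> lies in \<open>\<X>\<close>.
\<close>

section \<open>Additive calculus\<close>

context category
begin

lemma Mor_Obj: "f \<in> Mor C X Y \<Longrightarrow> X \<in> Obj C \<and> Y \<in> Obj C"
  using Dom_Obj Cod_Obj by (auto simp: Mor_def)

lemma Cmp_arr [simp]: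
  assumes "f \<in> Arr C" "g \<in> Arr C" "Cod C f = Dom C g"
  shows "g \<cdot> f \<in> Arr C" "Dom C (g \<cdot> f) = Dom C f" "Cod C (g \<cdot> f) = Cod C g"
  using Cmp_Mor[of f "Dom C f" "Cod C f" g "Cod C g"] assms by (auto simp: Mor_def)

lemma Ident_arr [simp]:
  assumes "X \<in> Obj C"
  shows "Ident C X \<in> Arr C" "Dom C (Ident C X) = X" "Cod C (Ident C X) = X"
  using Ident_Mor[OF assms] by (auto simp: Mor_def)

lemma Dom_Obj' [simp]: "f \<in> Arr C \<Longrightarrow> Dom C f \<in> Obj C"
  and Cod_Obj' [simp]: "f \<in> Arr C \<Longrightarrow> Cod C f \<in> Obj C"
  by (auto intro: Dom_Obj Cod_Obj)

lemma Cmp_Ident [simp]: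
  assumes "f \<in> Arr C"
  shows "Cod C f = Y \<Longrightarrow> Ident C Y \<cdot> f = f" "Dom C f = X \<Longrightarrow> f \<cdot> Ident C X = f"
  using Cmp_Ident_left[of f "Dom C f"] Cmp_Ident_right[of f _ "Cod C f"] assms
  by (auto simp: Mor_def)

lemma assoc:
  assumes "f \<in> Arr C" "g \<in> Arr C" "h \<in> Arr C" "Cod C f = Dom C g" "Cod C g = Dom C h"
  shows "(h \<cdot> g) \<cdot> f = h \<cdot> (g \<cdot> f)"
  using Cmp_assoc[of f "Dom C f" "Cod C f" g "Cod C g" h "Cod C h"] assms by (auto simp: Mor_def)

lemma isomorphism_Ident: "X \<in> Obj C \<Longrightarrow> isomorphism C (Ident C X)"
  unfolding isomorphism_def by (auto simp: Mor_def intro!: bexI[of _ "Ident C X"])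

lemma isomorphismI:
  assumes "f \<in> Mor C X Y" "g \<in> Mor C Y X" "g \<cdot> f = Ident C X" "f \<cdot> g = Ident C Y"
  shows "isomorphism C f"
  using assms unfolding isomorphism_def by (auto simp: Mor_def)

end

notation Add (infixl "\<oplus>\<index>" 65)

section \<open>Addition and negatives of arrows\<close>

context preadditive_category
begin

lemma Add_Mor:
  assumes "f \<in> Mor C X Y" "g \<in> Mor C X Y" shows "f \<oplus> g \<in> Mor C X Y"
proof -
  interpret G: comm_group "hom_group C X Y" using assms Mor_Obj hom_comm_group by blast
  show ?thesis using G.m_closed assms by (simp add: hom_group_def)
qed

lemma Zero_Mor:
  assumes "X \<in> Obj C" "Y \<in> Obj C" shows "Zero C X Y \<in> Mor C X Y"
proof -
  interpret G: comm_group "hom_group C X Y" using assms hom_comm_group by blast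
  show ?thesis using G.one_closed by (simp add: hom_group_def)
qed

lemma Add_arr [simp]:
  assumes "f \<in> Arr C" "g \<in> Arr C" "Dom C f = Dom C g" "Cod C f = Cod C g"
  shows "f \<oplus> g \<in> Arr C" "Dom C (f \<oplus> g) = Dom C g" "Cod C (f \<oplus> g) = Cod C g"
  using Add_Mor[of f "Dom C f" "Cod C f" g] assms by (auto simp: Mor_def)

lemma Zero_arr [simp]:
  assumes "X \<in> Obj C" "Y \<in> Obj C"
  shows "Zero C X Y \<in> Arr C" "Dom C (Zero C X Y) = X" "Cod C (Zero C X Y) = Y"
  using Zero_Mor[OF assms] by (auto simp: Mor_def)

text \<open>The group inverse is taken in the hom-group fixed by the arrow's own domain and
  codomain, so no objects have to be passed as arguments.\<close>

definition neg :: "'m \<Rightarrow> 'm" where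
  "neg f = inv\<^bsub>hom_group C (Dom C f) (Cod C f)\<^esub> f"

lemma neg_Mor:
  assumes "f \<in> Mor C X Y" shows "neg f \<in> Mor C X Y"
proof -
  interpret G: comm_group "hom_group C X Y" using assms Mor_Obj hom_comm_group by blast
  show ?thesis using G.inv_closed[of f] assms by (auto simp: hom_group_def neg_def Mor_def)
qed

lemma neg_arr [simp]:
  assumes "f \<in> Arr C"
  shows "neg f \<in> Arr C" "Dom C (neg f) = Dom C f" "Cod C (neg f) = Cod C f"
  using neg_Mor[of f "Dom C f" "Cod C f"] assms by (auto simp: Mor_def)

lemma Add_Zero [simp]:
  assumes "f \<in> Arr C" "Dom C f = X" "Cod C f = Y"
  shows "f \<oplus> Zero C X Y = f" "Zero C X Y \<oplus> f = f"
proof -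
  interpret G: comm_group "hom_group C X Y" using assms hom_comm_group by auto
  show "f \<oplus> Zero C X Y = f" "Zero C X Y \<oplus> f = f"
    using G.r_one[of f] G.l_one[of f] assms by (auto simp: hom_group_def Mor_def)
qed

lemma Add_neg [simp]:
  assumes "f \<in> Arr C"
  shows "f \<oplus> neg f = Zero C (Dom C f) (Cod C f)" "neg f \<oplus> f = Zero C (Dom C f) (Cod C f)"
proof -
  interpret G: comm_group "hom_group C (Dom C f) (Cod C f)" using assms hom_comm_group by auto
  show "f \<oplus> neg f = Zero C (Dom C f) (Cod C f)" "neg f \<oplus> f = Zero C (Dom C f) (Cod C f)"
    using G.r_inv[of f] G.l_inv[of f] assms by (auto simp: hom_group_def Mor_def neg_def)
qed

lemma Add_assoc:
  assumes "f \<in> Arr C" "g \<in> Arr C" "h \<in> Arr C" "Dom C f = Dom C g" "Cod C f = Cod C g"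
    "Dom C g = Dom C h" "Cod C g = Cod C h"
  shows "(f \<oplus> g) \<oplus> h = f \<oplus> (g \<oplus> h)"
proof -
  interpret G: comm_group "hom_group C (Dom C f) (Cod C f)" using assms hom_comm_group by auto
  show ?thesis using G.m_assoc[of f g h] assms by (auto simp: hom_group_def Mor_def)
qed

lemma Add_commute:
  assumes "f \<in> Arr C" "g \<in> Arr C" "Dom C f = Dom C g" "Cod C f = Cod C g"
  shows "f \<oplus> g = g \<oplus> f"
proof -
  interpret G: comm_group "hom_group C (Dom C f) (Cod C f)" using assms hom_comm_group by auto
  show ?thesis using G.m_comm[of f g] assms by (auto simp: hom_group_def Mor_def)
qed

lemma Add_left_commute:
  assumes "f \<in> Arr C" "g \<in> Arr C" "h \<in> Arr C" "Dom C f = Dom C g" "Cod C f = Cod C g"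
    "Dom C g = Dom C h" "Cod C g = Cod C h"
  shows "f \<oplus> (g \<oplus> h) = g \<oplus> (f \<oplus> h)"
  using Add_assoc[of f g h] Add_assoc[of g f h] Add_commute[of f g] assms by simp

lemma distrib_right:
  assumes "f \<in> Arr C" "g \<in> Arr C" "g' \<in> Arr C" "Cod C f = Dom C g" "Dom C g = Dom C g'"
    "Cod C g = Cod C g'"
  shows "(g \<oplus> g') \<cdot> f = g \<cdot> f \<oplus> g' \<cdot> f"
  using Cmp_Add_left[of f "Dom C f" "Cod C f" g "Cod C g" g'] assms by (auto simp: Mor_def)

lemma distrib_left:
  assumes "f \<in> Arr C" "f' \<in> Arr C" "g \<in> Arr C" "Cod C f = Dom C g" "Dom C f = Dom C f'"
    "Cod C f = Cod C f'"
  shows "g \<cdot> (f \<oplus> f') = g \<cdot> f \<oplus> g \<cdot> f'"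
  using Cmp_Add_right[of f "Dom C f" "Cod C f" f' g "Cod C g"] assms by (auto simp: Mor_def)

lemma Add_left_cancel:
  assumes "f \<in> Arr C" "g \<in> Arr C" "h \<in> Arr C" "Dom C f = Dom C g" "Cod C f = Cod C g"
    "Dom C g = Dom C h" "Cod C g = Cod C h" "f \<oplus> g = f \<oplus> h"
  shows "g = h"
proof -
  have "neg f \<oplus> (f \<oplus> g) = neg f \<oplus> (f \<oplus> h)" using assms by simp
  then show ?thesis using assms Add_assoc[of "neg f" f g] Add_assoc[of "neg f" f h] by simp
qed

lemma Add_idem_Zero:
  assumes "f \<in> Arr C" "f \<oplus> f = f"
  shows "f = Zero C (Dom C f) (Cod C f)"
  using Add_left_cancel[of f f "Zero C (Dom C f) (Cod C f)"] assms by simp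

lemma Cmp_Zero [simp]:
  assumes "g \<in> Arr C" "Dom C g = Y" "X \<in> Obj C"
  shows "g \<cdot> Zero C X Y = Zero C X (Cod C g)"
  using Add_idem_Zero[of "g \<cdot> Zero C X Y"] distrib_left[of "Zero C X Y" "Zero C X Y" g] assms
  by fastforce

lemma Zero_Cmp [simp]:
  assumes "f \<in> Arr C" "Cod C f = Y" "Z \<in> Obj C"
  shows "Zero C Y Z \<cdot> f = Zero C (Dom C f) Z"
  using Add_idem_Zero[of "Zero C Y Z \<cdot> f"] distrib_right[of f "Zero C Y Z" "Zero C Y Z"] assms
  by fastforce

lemma neg_unique:
  assumes "f \<in> Arr C" "g \<in> Arr C" "Dom C f = Dom C g" "Cod C f = Cod C g"
    "f \<oplus> g = Zero C (Dom C f) (Cod C f)"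
  shows "g = neg f"
  by (rule Add_left_cancel[of f]) (use assms in simp_all)

lemma Cmp_neg:
  assumes "f \<in> Arr C" "g \<in> Arr C" "Cod C f = Dom C g"
  shows "g \<cdot> neg f = neg (g \<cdot> f)" "neg g \<cdot> f = neg (g \<cdot> f)"
proof -
  show "g \<cdot> neg f = neg (g \<cdot> f)"
    using assms by (intro neg_unique) (simp_all add: distrib_left[symmetric])
  show "neg g \<cdot> f = neg (g \<cdot> f)"
    using assms by (intro neg_unique) (simp_all add: distrib_right[symmetric])
qed

text \<open>Moves a subtrahend across an equation, so that kernel lifts and the stable relation can
  be phrased with \<open>Add\<close> alone.\<close>

lemma eq_Add_iff:
  assumes "f \<in> Arr C" "g \<in> Arr C" "h \<in> Arr C" "Dom C f = Dom C g" "Cod C f = Cod C g"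
    "Dom C g = Dom C h" "Cod C g = Cod C h"
  shows "f \<oplus> neg g = h \<longleftrightarrow> f = g \<oplus> h"
proof
  assume "f \<oplus> neg g = h"
  then have "g \<oplus> h = g \<oplus> (f \<oplus> neg g)" by simp
  also have "\<dots> = f \<oplus> (g \<oplus> neg g)" using assms by (intro Add_left_commute) auto
  finally show "f = g \<oplus> h" using assms by simp
next
  assume "f = g \<oplus> h"
  then have "f \<oplus> neg g = (h \<oplus> g) \<oplus> neg g" using assms Add_commute[of g h] by simp
  also have "\<dots> = h \<oplus> (g \<oplus> neg g)" using assms by (intro Add_assoc) auto
  finally show "f \<oplus> neg g = h" using assms by simp
qed

section \<open>Kernels\<close>

lemma kernel_mono:
  assumes "is_kernel C i p" "i \<cdot> f = i \<cdot> g" "f \<in> Mor C T (Dom C i)" "g \<in> Mor C T (Dom C i)"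
  shows "f = g"
proof -
  obtain X Y Z where k: "i \<in> Mor C X Y" "p \<in> Mor C Y Z" "p \<cdot> i = Zero C X Z"
    and u: "\<forall>T. \<forall>f \<in> Mor C T Y. p \<cdot> f = Zero C T Z \<longrightarrow> (\<exists>!g. g \<in> Mor C T X \<and> i \<cdot> g = f)"
    using assms(1) unfolding is_kernel_def by blast
  have X: "X = Dom C i" using k by (simp add: Mor_def)
  have "i \<cdot> f \<in> Mor C T Y" using k assms by (simp add: Mor_def)
  moreover have "p \<cdot> (i \<cdot> f) = Zero C T Z"
    using k assms by (simp add: Mor_def assoc[symmetric]) (metis Cod_Obj Zero_Cmp)
  ultimately show ?thesis using u assms X by metis
qed

lemma kernel_lift:
  assumes "is_kernel C i p" "f \<in> Mor C T (Cod C i)" "p \<cdot> f = Zero C T (Cod C p)"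
  shows "\<exists>g \<in> Mor C T (Dom C i). i \<cdot> g = f"
proof -
  obtain X Y Z where k: "i \<in> Mor C X Y" "p \<in> Mor C Y Z"
    and u: "\<forall>T. \<forall>f \<in> Mor C T Y. p \<cdot> f = Zero C T Z \<longrightarrow> (\<exists>!g. g \<in> Mor C T X \<and> i \<cdot> g = f)"
    using assms(1) unfolding is_kernel_def by blast
  have "X = Dom C i" "Y = Cod C i" "Z = Cod C p" using k by (simp_all add: Mor_def)
  then show ?thesis using u assms(2,3) by blast
qed

text \<open>The difference of two lifts is killed by \<open>p\<close>, hence factors through the
  kernel \<open>i\<close>. This is how lifts along a deflation are compared later.\<close>

lemma kernel_difference:
  assumes k: "is_kernel C i p" and i: "i \<in> Mor C X Y" and p: "p \<in> Mor C Y Z"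
    and f: "f \<in> Mor C T Y" "g \<in> Mor C T Y" and eq: "p \<cdot> f = p \<cdot> g"
  shows "\<exists>h \<in> Mor C T X. f = g \<oplus> i \<cdot> h"
proof -
  have "p \<cdot> (f \<oplus> neg g) = Zero C T Z"
    using p f eq by (simp add: Mor_def distrib_left Cmp_neg)
  moreover have "f \<oplus> neg g \<in> Mor C T Y" using f by (simp add: Add_Mor neg_Mor)
  ultimately obtain h where h: "h \<in> Mor C T X" "i \<cdot> h = f \<oplus> neg g"
    using kernel_lift[OF k, of "f \<oplus> neg g" T] i p by (auto simp: Mor_def)
  then have "f = g \<oplus> i \<cdot> h"
    by (intro eq_Add_iff[THEN iffD1]) (use f i in \<open>simp_all add: Mor_def\<close>)
  then show ?thesis using h by blast
qed

end

section \<open>Conflations and syzygies\<close>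

context exact_category
begin

section \<open>Short exact sequences\<close>

text \<open>\<open>Confl\<close> records only the two arrows; naming the three objects as well makes
  the universal properties directly applicable.\<close>

definition ses :: "'m \<Rightarrow> 'm \<Rightarrow> 'o \<Rightarrow> 'o \<Rightarrow> 'o \<Rightarrow> bool" where
  "ses i p X Y Z \<longleftrightarrow> i \<in> Mor E X Y \<and> p \<in> Mor E Y Z \<and> (i, p) \<in> Confl E"

lemma sesD:
  assumes "ses i p X Y Z"
  shows "i \<in> Mor E X Y" "p \<in> Mor E Y Z" "(i, p) \<in> Confl E" "is_kernel E i p" "deflation E p"
    "X \<in> Obj E" "Y \<in> Obj E" "Z \<in> Obj E"
  using assms Mor_Obj Confl_kernel unfolding ses_def deflation_def by blast+

lemma Confl_ses:
  assumes "(i, p) \<in> Confl E"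
  shows "ses i p (Dom E i) (Cod E i) (Cod E p)"
proof -
  have "is_kernel E i p" using assms by (rule Confl_kernel)
  then show ?thesis using assms unfolding is_kernel_def ses_def by (auto simp: Mor_def)
qed

lemma deflation_ses:
  assumes "deflation E p" "p \<in> Mor E Y Z"
  obtains i X where "ses i p X Y Z"
proof -
  obtain i where i: "(i, p) \<in> Confl E" using assms unfolding deflation_def by blast
  from Confl_ses[OF i] assms(2) have "ses i p (Dom E i) Y Z"
    by (auto simp: ses_def Mor_def)
  then show ?thesis by (rule that)
qed

lemma ses_comp_Zero:
  assumes "ses i p X Y Z" shows "p \<cdot> i = Zero E X Z"
proof -
  have "is_kernel E i p" using sesD[OF assms] by blast
  then show ?thesis using sesD(1,2)[OF assms] unfolding is_kernel_def by (auto simp: Mor_def)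
qed

lemma ses_lift:
  assumes "ses i p X Y Z" "f \<in> Mor E T Y" "p \<cdot> f = Zero E T Z"
  obtains g where "g \<in> Mor E T X" "i \<cdot> g = f"
proof -
  have "\<exists>g \<in> Mor E T (Dom E i). i \<cdot> g = f"
    using kernel_lift[OF sesD(4)[OF assms(1)], of f T] assms sesD(1,2)[OF assms(1)]
    by (simp add: Mor_def)
  then show ?thesis using that sesD(1)[OF assms(1)] by (auto simp: Mor_def)
qed

lemma ses_mono:
  assumes "ses i p X Y Z" "i \<cdot> g = i \<cdot> h" "g \<in> Mor E T X" "h \<in> Mor E T X"
  shows "g = h"
  using kernel_mono[OF sesD(4)[OF assms(1)] assms(2)] assms(3,4) sesD(1)[OF assms(1)]
  by (auto simp: Mor_def)

lemma ses_difference: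
  assumes "ses i p X Y Z" "f \<in> Mor E T Y" "g \<in> Mor E T Y" "p \<cdot> f = p \<cdot> g"
  obtains h where "h \<in> Mor E T X" "f = g \<oplus> i \<cdot> h"
  using kernel_difference[OF sesD(4,1,2)[OF assms(1)] assms(2-4)] by blast

text \<open>The deflation already has a kernel \<open>j\<close> forming a conflation. The universal
  properties of \<open>i\<close> and \<open>j\<close> give mutually inverse arrows, and
  \<open>Confl_iso\<close> carries the conflation over. To prove exactness it thus suffices to
  recognise the kernel of a deflation.\<close>

lemma deflation_kernel_ses:
  assumes defl: "deflation E p" and p: "p \<in> Mor E Y Z" and i: "i \<in> Mor E X Y"
    and zero: "p \<cdot> i = Zero E X Z"
    and lift: "\<And>T f. f \<in> Mor E T Y \<Longrightarrow> p \<cdot> f = Zero E T Z \<Longrightarrow> \<exists>g \<in> Mor E T X. i \<cdot> g = f"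
    and mono: "\<And>T g h. g \<in> Mor E T X \<Longrightarrow> h \<in> Mor E T X \<Longrightarrow> i \<cdot> g = i \<cdot> h \<Longrightarrow> g = h"
  shows "ses i p X Y Z"
proof -
  obtain j K where j: "ses j p K Y Z" using deflation_ses[OF defl p] .
  note jD = sesD[OF j]
  obtain a where a: "a \<in> Mor E K X" "i \<cdot> a = j"
    using lift[OF jD(1) ses_comp_Zero[OF j]] by blast
  obtain b where b: "b \<in> Mor E X K" "j \<cdot> b = i" using ses_lift[OF j i zero] .
  have obj: "X \<in> Obj E" "K \<in> Obj E" "Y \<in> Obj E" "Z \<in> Obj E" using Mor_Obj[OF a(1)] jD by auto
  have "i \<cdot> (a \<cdot> b) = i \<cdot> Ident E X"
    using a b i obj by (simp add: Mor_def assoc[symmetric])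
  then have ab: "a \<cdot> b = Ident E X"
    using mono[of "a \<cdot> b" X "Ident E X"] a b obj by (simp add: Mor_def)
  have "j \<cdot> (b \<cdot> a) = j \<cdot> Ident E K"
    using a b jD(1) obj by (simp add: Mor_def assoc[symmetric])
  then have ba: "b \<cdot> a = Ident E K"
    using ses_mono[OF j, of "b \<cdot> a" "Ident E K" K] a b obj by (simp add: Mor_def)
  have "(i, p) \<in> Confl E"
  proof (rule Confl_iso[OF jD(3), of a X "Ident E Y" Y "Ident E Z" Z])
    show "isomorphism E a" by (rule isomorphismI[OF a(1) b(1) ba ab])
  qed (use a b i p jD(1,2) obj in \<open>simp_all add: Mor_def isomorphism_Ident\<close>)
  then show ?thesis using i p by (simp add: ses_def)
qed

lemma ses_iso_middle:
  assumes s: "ses j p K V Z" and b: "b \<in> Mor E V W" and a: "a \<in> Mor E W V"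
    and ab: "a \<cdot> b = Ident E V" and ba: "b \<cdot> a = Ident E W"
  shows "ses (b \<cdot> j) (p \<cdot> a) K W Z"
proof -
  note D = sesD[OF s]
  have "(b \<cdot> j, p \<cdot> a) \<in> Confl E"
  proof (rule Confl_iso[OF D(3), of "Ident E K" K b W "Ident E Z" Z])
    show "isomorphism E b" by (rule isomorphismI[OF b a ab ba])
    show "(p \<cdot> a) \<cdot> b = Ident E Z \<cdot> p"
      using a b ab D by (simp add: Mor_def assoc)
    show "(b \<cdot> j) \<cdot> Ident E K = b \<cdot> j" using a b D by (simp add: Mor_def)
  qed (use a b D in \<open>simp_all add: Mor_def isomorphism_Ident\<close>)
  then show ?thesis using a b D by (simp add: ses_def Mor_def)
qed

section \<open>Pullbacks of deflations\<close>

text \<open>\<open>is_pullback\<close> with its four objects made explicit: \<open>p'\<close> is the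
  base change of \<open>p\<close> along \<open>f\<close>, and \<open>f'\<close> that of
  \<open>f\<close> along \<open>p\<close>.\<close>

definition pb :: "'m \<Rightarrow> 'm \<Rightarrow> 'm \<Rightarrow> 'm \<Rightarrow> 'o \<Rightarrow> 'o \<Rightarrow> 'o \<Rightarrow> 'o \<Rightarrow> bool" where
  "pb p f p' f' Y X Z W \<longleftrightarrow>
     p \<in> Mor E Y Z \<and> f \<in> Mor E X Z \<and> p' \<in> Mor E W X \<and> f' \<in> Mor E W Y \<and>
     p \<cdot> f' = f \<cdot> p' \<and>
     (\<forall>T u v. u \<in> Mor E T Y \<longrightarrow> v \<in> Mor E T X \<longrightarrow> p \<cdot> u = f \<cdot> v \<longrightarrow>
        (\<exists>!w. w \<in> Mor E T W \<and> f' \<cdot> w = u \<and> p' \<cdot> w = v))"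

lemma pbD:
  assumes "pb p f p' f' Y X Z W"
  shows "p \<in> Mor E Y Z" "f \<in> Mor E X Z" "p' \<in> Mor E W X" "f' \<in> Mor E W Y"
    "p \<cdot> f' = f \<cdot> p'" "W \<in> Obj E" "X \<in> Obj E" "Y \<in> Obj E" "Z \<in> Obj E"
  using assms Mor_Obj unfolding pb_def by blast+

lemma pb_sym: "pb p f p' f' Y X Z W \<Longrightarrow> pb f p f' p' X Y Z W"
  unfolding pb_def by (auto; metis)

lemma pb_lift:
  assumes "pb p f p' f' Y X Z W" "u \<in> Mor E T Y" "v \<in> Mor E T X" "p \<cdot> u = f \<cdot> v"
  obtains w where "w \<in> Mor E T W" "f' \<cdot> w = u" "p' \<cdot> w = v"
  using assms unfolding pb_def by blast

lemma pb_unique: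
  assumes pb: "pb p f p' f' Y X Z W" and g: "g \<in> Mor E T W" and h: "h \<in> Mor E T W"
    and eq: "f' \<cdot> g = f' \<cdot> h" "p' \<cdot> g = p' \<cdot> h"
  shows "g = h"
proof -
  note D = pbD[OF pb]
  have mor: "f' \<cdot> h \<in> Mor E T Y" "p' \<cdot> h \<in> Mor E T X"
    using D h by (simp_all add: Mor_def)
  have "p \<cdot> (f' \<cdot> h) = (p \<cdot> f') \<cdot> h"
    using D(1-4) h by (simp add: Mor_def assoc)
  also have "\<dots> = f \<cdot> (p' \<cdot> h)"
    unfolding D(5) using D h by (simp add: Mor_def assoc)
  finally have "\<exists>!w. w \<in> Mor E T W \<and> f' \<cdot> w = f' \<cdot> h \<and> p' \<cdot> w = p' \<cdot> h"
    using pb mor unfolding pb_def by blast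
  then show ?thesis using g h eq by blast
qed

lemma pb_exists:
  assumes "deflation E p" "p \<in> Mor E Y Z" "f \<in> Mor E X Z"
  obtains p' f' W where "pb p f p' f' Y X Z W" "deflation E p'"
proof -
  obtain p' f' where p': "is_pullback E p f p' f'" "deflation E p'"
    using deflation_pullback[of p f] assms by (auto simp: Mor_def)
  then obtain Z0 Y0 X0 W where "pb p f p' f' Y0 X0 Z0 W"
    unfolding is_pullback_def pb_def by blast
  moreover from this have "Y0 = Y" "X0 = X" "Z0 = Z"
    using assms by (auto simp: pb_def Mor_def)
  ultimately show ?thesis using p' that by blast
qed

text \<open>The exactness axiom only provides some pullback whose projection is a deflation. Any two
  pullbacks are isomorphic over \<open>X\<close>, and \<open>ses_iso_middle\<close> transfers the
  property. This allows both projections of one square to be deflations.\<close>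

lemma pb_deflation:
  assumes pb: "pb p f p' f' Y X Z W" and defl: "deflation E p"
  shows "deflation E p'"
proof -
  note D = pbD[OF pb]
  obtain q g V where pb2: "pb p f q g Y X Z V" and q: "deflation E q"
    using pb_exists[OF defl D(1,2)] .
  note D2 = pbD[OF pb2]
  obtain a where a: "a \<in> Mor E W V" "g \<cdot> a = f'" "q \<cdot> a = p'"
    using pb_lift[OF pb2 D(4,3,5)] .
  obtain b where b: "b \<in> Mor E V W" "f' \<cdot> b = g" "p' \<cdot> b = q"
    using pb_lift[OF pb D2(4,3,5)] .
  have "f' \<cdot> (b \<cdot> a) = f' \<cdot> Ident E W" "p' \<cdot> (b \<cdot> a) = p' \<cdot> Ident E W"
    using a b D by (simp_all add: Mor_def assoc[symmetric])
  then have ba: "b \<cdot> a = Ident E W"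
    using pb_unique[OF pb, of "b \<cdot> a" W "Ident E W"] a b D by (simp add: Mor_def)
  have "g \<cdot> (a \<cdot> b) = g \<cdot> Ident E V" "q \<cdot> (a \<cdot> b) = q \<cdot> Ident E V"
    using a b D2 by (simp_all add: Mor_def assoc[symmetric])
  then have ab: "a \<cdot> b = Ident E V"
    using pb_unique[OF pb2, of "a \<cdot> b" V "Ident E V"] a b D2 by (simp add: Mor_def)
  obtain j K where "ses j q K V X" using deflation_ses[OF q D2(3)] .
  from sesD(5)[OF ses_iso_middle[OF this b(1) a(1) ab ba]] show ?thesis using a(3) by simp
qed

text \<open>Base change preserves the kernel: \<open>i'\<close> is the lift of the pair formed by
  \<open>i\<close> and zero, and a map killed by \<open>p'\<close> becomes, after composition with
  \<open>f'\<close>, a map killed by \<open>p\<close>.\<close>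

lemma pb_ses:
  assumes pb: "pb p f p' f' Y X Z W" and s: "ses i p K Y Z"
  obtains i' where "ses i' p' K W X" "f' \<cdot> i' = i"
proof -
  note D = pbD[OF pb] and S = sesD[OF s]
  have z: "Zero E K X \<in> Mor E K X" using D S by (simp add: Mor_def)
  obtain i' where i': "i' \<in> Mor E K W" "f' \<cdot> i' = i" "p' \<cdot> i' = Zero E K X"
    using pb_lift[OF pb S(1) z] ses_comp_Zero[OF s] D S by (auto simp: Mor_def)
  have "ses i' p' K W X"
  proof (rule deflation_kernel_ses[OF pb_deflation[OF pb S(5)] D(3) i'(1,3)])
    fix T h assume h: "h \<in> Mor E T W" "p' \<cdot> h = Zero E T X"
    have "p \<cdot> (f' \<cdot> h) = (p \<cdot> f') \<cdot> h" using D(1-4) h(1) by (simp add: Mor_def assoc)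
    also have "\<dots> = f \<cdot> (p' \<cdot> h)" unfolding D(5) using D h(1) by (simp add: Mor_def assoc)
    also have "\<dots> = Zero E T Z" unfolding h(2) using D h(1) by (auto simp: Mor_def)
    finally obtain g where g: "g \<in> Mor E T K" "i \<cdot> g = f' \<cdot> h"
      using ses_lift[OF s, of "f' \<cdot> h" T] D h(1) by (auto simp: Mor_def)
    have "f' \<cdot> (i' \<cdot> g) = f' \<cdot> h" "p' \<cdot> (i' \<cdot> g) = p' \<cdot> h"
      using g h i' D by (auto simp: Mor_def assoc[symmetric])
    then have "i' \<cdot> g = h"
      using pb_unique[OF pb, of "i' \<cdot> g" T h] g h(1) i' by (simp add: Mor_def)
    then show "\<exists>g \<in> Mor E T K. i' \<cdot> g = h" using g by blast
  next
    fix T g h assume g: "g \<in> Mor E T K" and h: "h \<in> Mor E T K" and eq: "i' \<cdot> g = i' \<cdot> h"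
    have "(f' \<cdot> i') \<cdot> g = f' \<cdot> (i' \<cdot> g)" using i'(1) D g by (simp add: Mor_def assoc)
    also have "\<dots> = f' \<cdot> (i' \<cdot> h)" using eq by simp
    also have "\<dots> = (f' \<cdot> i') \<cdot> h" using i'(1) D h by (simp add: Mor_def assoc)
    finally show "g = h" using ses_mono[OF s _ g h] i'(2) by simp
  qed
  then show ?thesis using i' that by blast
qed

text \<open>The kernel \<open>V\<close> of the composite is the preimage of \<open>S\<close> under
  \<open>q\<close>, that is, the pullback of \<open>q\<close> along \<open>s\<close>. As a base
  change of \<open>q\<close>, the projection to \<open>S\<close> has the same kernel
  \<open>D\<close>.\<close>

lemma ses_composite:
  assumes s: "ses s w S W C" and q: "ses d q D Q W"
  obtains t V e r where "ses t (w \<cdot> q) V Q C" "ses e r D V S"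
proof -
  note sD = sesD[OF s] and qD = sesD[OF q]
  obtain r t V where pb: "pb q s r t Q S W V" using pb_exists[OF qD(5,2) sD(1)] .
  note D = pbD[OF pb]
  obtain e where e: "ses e r D V S" using pb_ses[OF pb q] .
  have "ses t (w \<cdot> q) V Q C"
  proof (rule deflation_kernel_ses)
    show "deflation E (w \<cdot> q)" using deflation_Cmp[OF qD(5) sD(5)] sD qD by (simp add: Mor_def)
    show "w \<cdot> q \<in> Mor E Q C" using sD qD by (simp add: Mor_def)
    show "t \<in> Mor E V Q" by (rule D)
    have "(w \<cdot> q) \<cdot> t = w \<cdot> (q \<cdot> t)" using sD(2) qD(2) D(4) by (simp add: Mor_def assoc)
    also have "\<dots> = (w \<cdot> s) \<cdot> r" unfolding D(5) using sD(1,2) D(3) by (simp add: Mor_def assoc)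
    also have "\<dots> = Zero E V C" unfolding ses_comp_Zero[OF s] using sD(6,8) D(3) by (auto simp: Mor_def)
    finally show "(w \<cdot> q) \<cdot> t = Zero E V C" .
  next
    fix T f assume f: "f \<in> Mor E T Q" "(w \<cdot> q) \<cdot> f = Zero E T C"
    have "w \<cdot> (q \<cdot> f) = Zero E T C" using f sD(2) qD(2) by (simp add: Mor_def assoc)
    then obtain g where g: "g \<in> Mor E T S" "s \<cdot> g = q \<cdot> f"
      using ses_lift[OF s, of "q \<cdot> f" T] f(1) qD(2) by (auto simp: Mor_def)
    then show "\<exists>g \<in> Mor E T V. t \<cdot> g = f" using pb_lift[OF pb f(1) g(1)] by metis
  next
    fix T g h assume g: "g \<in> Mor E T V" and h: "h \<in> Mor E T V" and eq: "t \<cdot> g = t \<cdot> h"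
    have "s \<cdot> (r \<cdot> g) = (q \<cdot> t) \<cdot> g" unfolding D(5) using D g sD(1) by (simp add: Mor_def assoc)
    also have "\<dots> = q \<cdot> (t \<cdot> h)" using D(1-4) g eq qD(2) by (simp add: Mor_def assoc)
    also have "\<dots> = (q \<cdot> t) \<cdot> h" using D(1-4) h qD(2) by (simp add: Mor_def assoc)
    also have "\<dots> = s \<cdot> (r \<cdot> h)" unfolding D(5) using D h sD(1) by (simp add: Mor_def assoc)
    finally have "r \<cdot> g = r \<cdot> h"
      using ses_mono[OF s, of "r \<cdot> g" "r \<cdot> h" T] D g h by (simp add: Mor_def)
    then show "g = h" using pb_unique[OF pb g h eq] by blast
  qed
  then show ?thesis using e that by blast
qed

section \<open>Projective objects and syzygies\<close>

lemma Proj_lift: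
  assumes "P \<in> Proj E" "ses i p X Y Z" "f \<in> Mor E P Z"
  obtains g where "g \<in> Mor E P Y" "p \<cdot> g = f"
  using assms sesD[OF assms(2)] unfolding Proj_def by blast

lemma Proj_Obj: "P \<in> Proj E \<Longrightarrow> P \<in> Obj E"
  unfolding Proj_def by simp

text \<open>Extend the map to \<open>P\<close> along \<open>e\<close>, lift it there, and restrict
  the lift along \<open>m\<close>.\<close>

lemma Proj_retract:
  assumes P: "P \<in> Proj E" and m: "m \<in> Mor E R P" and e: "e \<in> Mor E P R"
    and em: "e \<cdot> m = Ident E R"
  shows "R \<in> Proj E"
  unfolding Proj_def
proof (clarsimp, intro conjI allI impI ballI)
  show "R \<in> Obj E" using m Mor_Obj by blast
  fix Y Z p f assume p: "p \<in> Mor E Y Z" "deflation E p" and f: "f \<in> Mor E R Z"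
  have "f \<cdot> e \<in> Mor E P Z" using f e by (simp add: Mor_def)
  then obtain g where g: "g \<in> Mor E P Y" "p \<cdot> g = f \<cdot> e" using P p unfolding Proj_def by blast
  have "p \<cdot> (g \<cdot> m) = (f \<cdot> e) \<cdot> m" unfolding g(2)[symmetric] using p g(1) m by (simp add: Mor_def assoc)
  also have "\<dots> = f \<cdot> (e \<cdot> m)" using f e m by (simp add: Mor_def assoc)
  also have "\<dots> = f" using em f by (simp add: Mor_def)
  finally show "\<exists>g \<in> Mor E R Y. p \<cdot> g = f" using g(1) m by (intro bexI[of _ "g \<cdot> m"]) (simp_all add: Mor_def)
qed

lemma Proj_biproduct:
  assumes P: "P \<in> Proj E" and Q: "Q \<in> Proj E" and S: "S \<in> Obj E" and bi: "is_biproduct E S P Q"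
  shows "S \<in> Proj E"
  unfolding Proj_def
proof (clarsimp simp: S)
  fix Y Z p f assume p: "p \<in> Mor E Y Z" "deflation E p" and f: "f \<in> Mor E S Z"
  obtain i1 i2 p1 p2 where b: "i1 \<in> Mor E P S" "i2 \<in> Mor E Q S" "p1 \<in> Mor E S P" "p2 \<in> Mor E S Q"
    "(i1 \<cdot> p1) \<oplus> (i2 \<cdot> p2) = Ident E S"
    using bi unfolding is_biproduct_def by auto
  have "f \<cdot> i1 \<in> Mor E P Z" "f \<cdot> i2 \<in> Mor E Q Z" using f b by (simp_all add: Mor_def)
  then obtain g1 g2 where g: "g1 \<in> Mor E P Y" "p \<cdot> g1 = f \<cdot> i1" "g2 \<in> Mor E Q Y" "p \<cdot> g2 = f \<cdot> i2"
    using P Q p unfolding Proj_def by blast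
  have "p \<cdot> ((g1 \<cdot> p1) \<oplus> (g2 \<cdot> p2)) = ((p \<cdot> g1) \<cdot> p1) \<oplus> ((p \<cdot> g2) \<cdot> p2)"
    using p g(1,3) b(1-4) by (simp add: Mor_def distrib_left assoc)
  also have "\<dots> = f \<cdot> ((i1 \<cdot> p1) \<oplus> (i2 \<cdot> p2))"
    unfolding g(2,4) using f b(1-4) by (simp add: Mor_def distrib_left assoc)
  also have "\<dots> = f" unfolding b(5) using f by (simp add: Mor_def)
  finally show "\<exists>g \<in> Mor E S Y. p \<cdot> g = f"
    using g(1,3) b(1-4) by (intro bexI[of _ "(g1 \<cdot> p1) \<oplus> (g2 \<cdot> p2)"]) (simp_all add: Mor_def)
qed

text \<open>Projectivity of \<open>P\<close> gives a section \<open>h\<close> of \<open>p\<close>.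
  Then the identity of \<open>Q\<close> minus \<open>h \<cdot> p\<close> factors as
  \<open>i \<cdot> r\<close>, and \<open>r\<close> retracts \<open>Q\<close> onto
  \<open>R\<close>.\<close>

lemma Proj_deflation_kernel:
  assumes s: "ses i p R Q P" and P: "P \<in> Proj E" and Q: "Q \<in> Proj E"
  shows "R \<in> Proj E"
proof -
  note D = sesD[OF s]
  obtain h where h: "h \<in> Mor E P Q" "p \<cdot> h = Ident E P"
    using Proj_lift[OF P s Ident_Mor] D by blast
  have "p \<cdot> Ident E Q = p \<cdot> (h \<cdot> p)"
    using h D by (simp add: Mor_def assoc[symmetric])
  then obtain r where r: "r \<in> Mor E Q R" "Ident E Q = (h \<cdot> p) \<oplus> (i \<cdot> r)"
    using ses_difference[OF s, of "Ident E Q" Q "h \<cdot> p"] h D by (auto simp: Mor_def)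
  have "i \<cdot> Ident E R = ((h \<cdot> p) \<oplus> (i \<cdot> r)) \<cdot> i" unfolding r(2)[symmetric] using D by (simp add: Mor_def)
  also have "\<dots> = (h \<cdot> (p \<cdot> i)) \<oplus> (i \<cdot> (r \<cdot> i))"
    using D h(1) r(1) by (simp add: Mor_def distrib_right assoc)
  also have "\<dots> = i \<cdot> (r \<cdot> i)" unfolding ses_comp_Zero[OF s] using D h(1) r(1) by (auto simp: Mor_def)
  finally have "r \<cdot> i = Ident E R"
    using ses_mono[OF s, of "r \<cdot> i" "Ident E R" R] r(1) D by (simp add: Mor_def)
  then show ?thesis using Proj_retract[OF Q D(1) r(1)] by blast
qed

text \<open>A relation instead of a function: the powers \<open>syz ^^ n\<close> cover all
  \<open>n\<close>-th syzygies, in particular those of any two syzygy choices, and leave room for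
  the kernels built by the horseshoe construction.\<close>

definition syz :: "'o \<Rightarrow> 'o \<Rightarrow> bool" where
  "syz X S \<longleftrightarrow> (\<exists>P i p. P \<in> Proj E \<and> ses i p S P X)"

lemma syz_Obj: "syz X S \<Longrightarrow> X \<in> Obj E \<and> S \<in> Obj E"
  unfolding syz_def using sesD(6,8) by blast

text \<open>With \<open>W\<close> the pullback of \<open>C \<rightarrow> Z\<close> along \<open>P \<rightarrow> Z\<close> and \<open>Q \<rightarrow> W\<close> a deflation from a projective,
  \<open>D\<close> and \<open>D'\<close> are the kernels of \<open>Q \<rightarrow> C\<close> and \<open>Q \<rightarrow> W\<close>.\<close>

lemma horseshoe:
  assumes enough: "enough_projectives E" and s: "ses i p Z' C Z" and syz: "syz Z S"
  obtains j q D' D where "ses j q D' D S" "syz C D" "syz Z' D'"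
proof -
  obtain P k \<pi> where P: "P \<in> Proj E" and k: "ses k \<pi> S P Z" using syz unfolding syz_def by blast
  note sD = sesD[OF s] and kD = sesD[OF k]
  \<comment> \<open>The two projections make \<open>W\<close> an extension of \<open>P\<close> by
    \<open>Z'\<close> and of \<open>C\<close> by \<open>S\<close>; composing each with
    \<open>Q -> W\<close> yields the two columns of the diagram.\<close>
  obtain p' \<pi>' W where pb: "pb p \<pi> p' \<pi>' C P Z W" using pb_exists[OF sD(5,2) kD(2)] .
  obtain i' where i': "ses i' p' Z' W P" using pb_ses[OF pb s] .
  obtain k' where k': "ses k' \<pi>' S W C" using pb_ses[OF pb_sym[OF pb] k] .
  obtain Q q where Q: "Q \<in> Proj E" "q \<in> Mor E Q W" "deflation E q"
    using enough pbD(6)[OF pb] unfolding enough_projectives_def by blast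
  obtain d D' where d: "ses d q D' Q W" using deflation_ses[OF Q(3,2)] .
  obtain t D e r where 1: "ses t (\<pi>' \<cdot> q) D Q C" "ses e r D' D S" using ses_composite[OF k' d] .
  obtain t' R e' r' where 2: "ses t' (p' \<cdot> q) R Q P" "ses e' r' D' R Z'" using ses_composite[OF i' d] .
  \<comment> \<open>\<open>R\<close> is the kernel of the deflation \<open>Q -> P\<close> between
    projectives, so the sequence from \<open>D'\<close> through \<open>R\<close> to
    \<open>Z'\<close> exhibits \<open>D'\<close> as a syzygy of \<open>Z'\<close>.\<close>
  have "R \<in> Proj E" by (rule Proj_deflation_kernel[OF 2(1) P Q(1)])
  then have "syz Z' D'" "syz C D" using 1 2 Q(1) unfolding syz_def by blast+
  then show ?thesis using that 1(2) by blast
qed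

end

section \<open>Stable retracts\<close>

context exact_category
begin

section \<open>The ideal of maps factoring through projectives\<close>

lemma proj_idealI: "P \<in> Proj E \<Longrightarrow> a \<in> Mor E X P \<Longrightarrow> b \<in> Mor E P Y \<Longrightarrow> b \<cdot> a \<in> proj_ideal E X Y"
  unfolding proj_ideal_def by blast

lemma proj_idealE:
  assumes "e \<in> proj_ideal E X Y"
  obtains a b P where "P \<in> Proj E" "a \<in> Mor E X P" "b \<in> Mor E P Y" "e = b \<cdot> a"
  using assms unfolding proj_ideal_def by blast

lemma proj_ideal_Mor: "e \<in> proj_ideal E X Y \<Longrightarrow> e \<in> Mor E X Y"
  by (auto elim!: proj_idealE simp: Mor_def)

lemma proj_ideal_Cmp_left:
  assumes "e \<in> proj_ideal E X Y" "f \<in> Mor E Y Z" shows "f \<cdot> e \<in> proj_ideal E X Z"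
proof -
  obtain a b P where e: "P \<in> Proj E" "a \<in> Mor E X P" "b \<in> Mor E P Y" "e = b \<cdot> a"
    using proj_idealE[OF assms(1)] .
  then have "f \<cdot> e = (f \<cdot> b) \<cdot> a" "f \<cdot> b \<in> Mor E P Z" using assms(2) by (simp_all add: Mor_def assoc)
  then show ?thesis using proj_idealI[OF e(1,2)] by simp
qed

lemma proj_ideal_Cmp_right:
  assumes "e \<in> proj_ideal E Y Z" "f \<in> Mor E X Y" shows "e \<cdot> f \<in> proj_ideal E X Z"
proof -
  obtain a b P where e: "P \<in> Proj E" "a \<in> Mor E Y P" "b \<in> Mor E P Z" "e = b \<cdot> a"
    using proj_idealE[OF assms(1)] .
  then have "e \<cdot> f = b \<cdot> (a \<cdot> f)" "a \<cdot> f \<in> Mor E X P" using assms(2) by (simp_all add: Mor_def assoc)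
  then show ?thesis using proj_idealI[OF e(1) _ e(3)] by simp
qed

lemma proj_ideal_neg:
  assumes "e \<in> proj_ideal E X Y" shows "neg e \<in> proj_ideal E X Y"
proof -
  obtain a b P where e: "P \<in> Proj E" "a \<in> Mor E X P" "b \<in> Mor E P Y" "e = b \<cdot> a"
    using proj_idealE[OF assms] .
  then have "neg e = neg b \<cdot> a" by (simp add: Mor_def Cmp_neg)
  then show ?thesis using proj_idealI[OF e(1,2) neg_Mor[OF e(3)]] by simp
qed

text \<open>Two factorisations merge into one through the biproduct of \<open>P\<close> and
  \<open>P'\<close>, with a column \<open>?a\<close> into it and a row \<open>?b\<close> out of
  it.\<close>

lemma proj_ideal_Add:
  assumes "e \<in> proj_ideal E X Y" "e' \<in> proj_ideal E X Y" shows "e \<oplus> e' \<in> proj_ideal E X Y"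
proof -
  obtain a b P where e: "P \<in> Proj E" "a \<in> Mor E X P" "b \<in> Mor E P Y" "e = b \<cdot> a"
    using proj_idealE[OF assms(1)] .
  obtain a' b' P' where e': "P' \<in> Proj E" "a' \<in> Mor E X P'" "b' \<in> Mor E P' Y" "e' = b' \<cdot> a'"
    using proj_idealE[OF assms(2)] .
  have obj: "P \<in> Obj E" "P' \<in> Obj E" "X \<in> Obj E" "Y \<in> Obj E" using e e' Mor_Obj by blast+
  obtain S where S: "S \<in> Obj E" "is_biproduct E S P P'" using ex_biproduct obj by blast
  obtain i1 i2 p1 p2 where b: "i1 \<in> Mor E P S" "i2 \<in> Mor E P' S" "p1 \<in> Mor E S P" "p2 \<in> Mor E S P'"
    "p1 \<cdot> i1 = Ident E P" "p2 \<cdot> i2 = Ident E P'" "p1 \<cdot> i2 = Zero E P' P" "p2 \<cdot> i1 = Zero E P P'"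
    using S(2) unfolding is_biproduct_def by auto
  let ?a = "(i1 \<cdot> a) \<oplus> (i2 \<cdot> a')" and ?b = "(b \<cdot> p1) \<oplus> (b' \<cdot> p2)"
  have ab: "?a \<in> Mor E X S" "?b \<in> Mor E S Y" using b(1-4) e(2,3) e'(2,3) by (simp_all add: Mor_def)
  have 1: "p1 \<cdot> ?a = (p1 \<cdot> i1) \<cdot> a \<oplus> (p1 \<cdot> i2) \<cdot> a'" "p2 \<cdot> ?a = (p2 \<cdot> i1) \<cdot> a \<oplus> (p2 \<cdot> i2) \<cdot> a'"
    using b(1-4) e(2,3) e'(2,3) by (simp_all add: Mor_def distrib_left assoc)
  have 2: "p1 \<cdot> ?a = a" "p2 \<cdot> ?a = a'"
    unfolding 1 b(5-8) using b(1-4) e(2,3) e'(2,3) obj by (simp_all add: Mor_def)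
  have "?b \<cdot> ?a = b \<cdot> (p1 \<cdot> ?a) \<oplus> b' \<cdot> (p2 \<cdot> ?a)"
    using b(1-4) e(2,3) e'(2,3) by (simp add: Mor_def distrib_right assoc)
  then have "?b \<cdot> ?a = e \<oplus> e'" unfolding 2 e(4) e'(4) .
  then show ?thesis
    using proj_idealI[OF Proj_biproduct[OF e(1) e'(1) S] ab] by simp
qed

text \<open>A zero object is projective, because two maps from it to the same object always agree,
  and the zero map factors through it.\<close>

lemma Zero_proj_ideal:
  assumes "X \<in> Obj E" "Y \<in> Obj E" shows "Zero E X Y \<in> proj_ideal E X Y"
proof -
  obtain Z where Z: "zero_object E Z" using ex_zero_object by blast
  then have Z': "Z \<in> Obj E" unfolding zero_object_def by simp
  have "Z \<in> Proj E"
  proof -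
    have "\<exists>g \<in> Mor E Z Y. p \<cdot> g = f" if "p \<in> Mor E Y V" "f \<in> Mor E Z V" for p f Y V
    proof -
      have obj: "Y \<in> Obj E" "V \<in> Obj E" using that Mor_Obj by blast+
      have "Zero E Z Y \<in> Mor E Z Y" "p \<cdot> Zero E Z Y \<in> Mor E Z V"
        using that(1) obj Z' by (simp_all add: Mor_def)
      moreover have "\<exists>!h. h \<in> Mor E Z V" using Z obj unfolding zero_object_def by blast
      ultimately show ?thesis using that(2) by blast
    qed
    then show ?thesis using Z' unfolding Proj_def by blast
  qed
  from proj_idealI[OF this Zero_Mor Zero_Mor, of X Y] show ?thesis using assms Z' by simp
qed

section \<open>The stable relation and the stable category\<close>

lemma stable_rel_iff:
  "(f, g) \<in> stable_rel E \<longleftrightarrow>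
     (\<exists>X Y. f \<in> Mor E X Y \<and> g \<in> Mor E X Y \<and> (\<exists>e \<in> proj_ideal E X Y. f = g \<oplus> e))"
proof -
  have "f \<otimes>\<^bsub>hom_group E X Y\<^esub> inv\<^bsub>hom_group E X Y\<^esub> g \<in> proj_ideal E X Y \<longleftrightarrow>
      (\<exists>e \<in> proj_ideal E X Y. f = g \<oplus> e)" if "f \<in> Mor E X Y" "g \<in> Mor E X Y" for X Y
  proof -
    have "f \<otimes>\<^bsub>hom_group E X Y\<^esub> inv\<^bsub>hom_group E X Y\<^esub> g = f \<oplus> neg g"
      using that by (simp add: neg_def Mor_def hom_group_def)
    moreover have "f \<oplus> neg g = e \<longleftrightarrow> f = g \<oplus> e" if "e \<in> proj_ideal E X Y" for e
      by (rule eq_Add_iff)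
        (use that proj_ideal_Mor[OF that] \<open>f \<in> _\<close> \<open>g \<in> _\<close> in \<open>simp_all add: Mor_def\<close>)
    ultimately show ?thesis by metis
  qed
  then show ?thesis unfolding stable_rel_def by blast
qed

lemma equiv_stable_rel: "equiv (Arr E) (stable_rel E)"
proof (rule equivI)
  show "stable_rel E \<subseteq> Arr E \<times> Arr E" unfolding stable_rel_def by (auto simp: Mor_def)
  show "refl_on (Arr E) (stable_rel E)"
  proof (rule refl_onI)
    fix f assume f: "f \<in> Arr E"
    then have "f = f \<oplus> Zero E (Dom E f) (Cod E f)" by simp
    moreover have "Zero E (Dom E f) (Cod E f) \<in> proj_ideal E (Dom E f) (Cod E f)"
      using f by (intro Zero_proj_ideal) simp_all
    ultimately have "\<exists>e \<in> proj_ideal E (Dom E f) (Cod E f). f = f \<oplus> e" by blast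
    moreover have "f \<in> Mor E (Dom E f) (Cod E f)" using f by (simp add: Mor_def)
    ultimately show "(f, f) \<in> stable_rel E" unfolding stable_rel_iff by blast
  qed
  show "sym (stable_rel E)"
  proof (rule symI)
    fix f g assume "(f, g) \<in> stable_rel E"
    then obtain X Y e where m: "f \<in> Mor E X Y" "g \<in> Mor E X Y" and e: "e \<in> proj_ideal E X Y" "f = g \<oplus> e"
      unfolding stable_rel_iff by blast
    have "(g \<oplus> e) \<oplus> neg e = g \<oplus> (e \<oplus> neg e)"
      using m(2) proj_ideal_Mor[OF e(1)] by (intro Add_assoc) (simp_all add: Mor_def)
    then have "g = f \<oplus> neg e"
      using m(2) proj_ideal_Mor[OF e(1)] e(2) by (simp add: Mor_def)
    then show "(g, f) \<in> stable_rel E" unfolding stable_rel_iff using m proj_ideal_neg[OF e(1)] by blast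
  qed
  show "trans (stable_rel E)"
  proof (rule transI)
    fix f g h assume "(f, g) \<in> stable_rel E" "(g, h) \<in> stable_rel E"
    then obtain X Y e X' Y' e' where
      m: "f \<in> Mor E X Y" "g \<in> Mor E X Y" "g \<in> Mor E X' Y'" "h \<in> Mor E X' Y'"
      and e: "e \<in> proj_ideal E X Y" "f = g \<oplus> e" and e': "e' \<in> proj_ideal E X' Y'" "g = h \<oplus> e'"
      unfolding stable_rel_iff by blast
    have X: "X' = X" "Y' = Y" using m by (auto simp: Mor_def)
    have "(h \<oplus> e') \<oplus> e = h \<oplus> (e' \<oplus> e)"
      using m(4) proj_ideal_Mor[OF e(1)] proj_ideal_Mor[OF e'(1)] X
      by (intro Add_assoc) (simp_all add: Mor_def)
    then have "f = h \<oplus> (e' \<oplus> e)" using e(2) e'(2) by simp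
    then show "(f, h) \<in> stable_rel E"
      unfolding stable_rel_iff using m proj_ideal_Add e(1) e'(1) X by blast
  qed
qed

text \<open>Expanding \<open>(g' \<oplus> e') \<cdot> (f' \<oplus> e)\<close> leaves the error
  \<open>g' \<cdot> e \<oplus> e' \<cdot> f\<close>, which lies in the ideal.\<close>

lemma stable_rel_Cmp:
  assumes "(f, f') \<in> stable_rel E" "(g, g') \<in> stable_rel E" "Cod E f = Dom E g"
  shows "(g \<cdot> f, g' \<cdot> f') \<in> stable_rel E"
proof -
  obtain X Y e Y' Z e' where
    m: "f \<in> Mor E X Y" "f' \<in> Mor E X Y" "g \<in> Mor E Y' Z" "g' \<in> Mor E Y' Z"
    and e: "e \<in> proj_ideal E X Y" "f = f' \<oplus> e" and e': "e' \<in> proj_ideal E Y' Z" "g = g' \<oplus> e'"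
    using assms(1,2) unfolding stable_rel_iff by blast
  have Y: "Y' = Y" using m assms(3) by (auto simp: Mor_def)
  note mor = m[unfolded Y] proj_ideal_Mor[OF e(1)] proj_ideal_Mor[OF e'(1)[unfolded Y]]
  have "(g' \<oplus> e') \<cdot> f = g' \<cdot> f \<oplus> e' \<cdot> f"
    using mor by (intro distrib_right) (simp_all add: Mor_def)
  also have "g' \<cdot> f = g' \<cdot> f' \<oplus> g' \<cdot> e"
    unfolding e(2) using mor by (intro distrib_left) (simp_all add: Mor_def)
  also have "(g' \<cdot> f' \<oplus> g' \<cdot> e) \<oplus> e' \<cdot> f = g' \<cdot> f' \<oplus> (g' \<cdot> e \<oplus> e' \<cdot> f)"
    using mor by (intro Add_assoc) (simp_all add: Mor_def)
  finally have "g \<cdot> f = g' \<cdot> f' \<oplus> (g' \<cdot> e \<oplus> e' \<cdot> f)" using e'(2) by simp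
  moreover have "g' \<cdot> e \<oplus> e' \<cdot> f \<in> proj_ideal E X Z"
    using mor e(1) e'(1) Y by (intro proj_ideal_Add proj_ideal_Cmp_left[of e X Y] proj_ideal_Cmp_right[of e' Y]) auto
  moreover have "g \<cdot> f \<in> Mor E X Z" "g' \<cdot> f' \<in> Mor E X Z" using mor by (simp_all add: Mor_def)
  ultimately show ?thesis unfolding stable_rel_iff by blast
qed

abbreviation stable_class :: "'m \<Rightarrow> 'm set" where
  "stable_class f \<equiv> stable_rel E `` {f}"

lemma stable_class_self: "f \<in> Arr E \<Longrightarrow> f \<in> stable_class f"
  using equiv_stable_rel by (rule equiv_class_self)

text \<open>All members of a class are parallel, so the images under \<open>Dom\<close> and
  \<open>Cod\<close> are singletons and \<open>the_elem\<close> is meaningful.\<close>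

lemma stable_class_Dom_Cod:
  assumes "f \<in> Arr E"
  shows "the_elem (Dom E ` stable_class f) = Dom E f" "the_elem (Cod E ` stable_class f) = Cod E f"
proof -
  have "g \<in> stable_class f \<Longrightarrow> Dom E g = Dom E f \<and> Cod E g = Cod E f" for g
    unfolding stable_rel_def by (auto simp: Mor_def)
  then have "Dom E ` stable_class f = {Dom E f}" "Cod E ` stable_class f = {Cod E f}"
    using stable_class_self[OF assms] by blast+
  then show "the_elem (Dom E ` stable_class f) = Dom E f" "the_elem (Cod E ` stable_class f) = Cod E f"
    by simp_all
qed

lemma Mor_stable_category: "Mor (stable_category E) X Y = stable_class ` Mor E X Y"
proof -
  have "(U \<in> Arr E // stable_rel E \<and> the_elem (Dom E ` U) = X \<and> the_elem (Cod E ` U) = Y) \<longleftrightarrow>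
      (\<exists>f \<in> Mor E X Y. U = stable_class f)" for U
    using stable_class_Dom_Cod by (auto simp: Mor_def elim!: quotientE intro: quotientI)
  then show ?thesis unfolding Mor_def[of "stable_category E"] by (auto simp: stable_category_def)
qed

text \<open>All composites of representatives are stably equal, so saturating the set of these
  composites gives a single class.\<close>

lemma Cmp_stable_category:
  assumes f: "f \<in> Mor E X Y" and g: "g \<in> Mor E Y Z"
  shows "stable_class g \<cdot>\<^bsub>stable_category E\<^esub> stable_class f = stable_class (g \<cdot> f)"
proof -
  have *: "(g \<cdot> f, g' \<cdot> f') \<in> stable_rel E" if "f' \<in> stable_class f" "g' \<in> stable_class g" for f' g'
    using stable_rel_Cmp[of f f' g g'] that f g by (simp add: Mor_def)
  have "stable_class (g \<cdot> f) \<subseteq> stable_rel E `` {g' \<cdot> f' | g' f'. g' \<in> stable_class g \<and> f' \<in> stable_class f}"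
    using stable_class_self[of f] stable_class_self[of g] f g by (fastforce simp: Mor_def)
  moreover have "stable_rel E `` {g' \<cdot> f' | g' f'. g' \<in> stable_class g \<and> f' \<in> stable_class f} \<subseteq> stable_class (g \<cdot> f)"
    using * equiv_stable_rel by (auto elim!: equivE dest: transD)
  ultimately show ?thesis by (auto simp: stable_category_def)
qed

section \<open>Stable retracts and their syzygies\<close>

text \<open>Stable retraction in terms of representatives: \<open>v \<cdot> u\<close> is the
  identity up to an error in the ideal. All later arguments compute with honest arrows.\<close>

definition sretract :: "'o \<Rightarrow> 'o \<Rightarrow> bool" where
  "sretract X Y \<longleftrightarrow> (\<exists>u \<in> Mor E X Y. \<exists>v \<in> Mor E Y X. \<exists>e \<in> proj_ideal E X X. Ident E X = v \<cdot> u \<oplus> e)"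

lemma stable_retract_iff: "stable_retract E X Y \<longleftrightarrow> sretract X Y"
proof -
  have "stable_class v \<cdot>\<^bsub>stable_category E\<^esub> stable_class u = Ident (stable_category E) X \<longleftrightarrow>
      (\<exists>e \<in> proj_ideal E X X. Ident E X = v \<cdot> u \<oplus> e)" if "u \<in> Mor E X Y" "v \<in> Mor E Y X" for u v
  proof -
    have m: "v \<cdot> u \<in> Mor E X X" "Ident E X \<in> Mor E X X" using that Mor_Obj[OF that(1)] by (simp_all add: Mor_def)
    have "stable_class v \<cdot>\<^bsub>stable_category E\<^esub> stable_class u = Ident (stable_category E) X \<longleftrightarrow>
        stable_class (Ident E X) = stable_class (v \<cdot> u)"
      unfolding Cmp_stable_category[OF that] by (auto simp: stable_category_def)
    also have "\<dots> \<longleftrightarrow> (Ident E X, v \<cdot> u) \<in> stable_rel E"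
      using m by (intro eq_equiv_class_iff[OF equiv_stable_rel]) (simp_all add: Mor_def)
    also have "\<dots> \<longleftrightarrow> (\<exists>e \<in> proj_ideal E X X. Ident E X = v \<cdot> u \<oplus> e)"
      unfolding stable_rel_iff using m by (auto simp: Mor_def)
    finally show ?thesis .
  qed
  then show ?thesis unfolding stable_retract_def retract_def sretract_def Mor_stable_category by auto
qed

lemma sretract_Obj: "sretract X Y \<Longrightarrow> X \<in> Obj E \<and> Y \<in> Obj E"
  unfolding sretract_def using Mor_Obj by blast

lemma retract_sretract:
  assumes "u \<in> Mor E X Y" "v \<in> Mor E Y X" "v \<cdot> u = Ident E X"
  shows "sretract X Y"
proof -
  have X: "X \<in> Obj E" using Mor_Obj assms by blast
  then have "Ident E X = v \<cdot> u \<oplus> Zero E X X" using assms(3) by simp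
  then show ?thesis unfolding sretract_def using assms Zero_proj_ideal[OF X X] by blast
qed

lemma sretract_refl: "X \<in> Obj E \<Longrightarrow> sretract X X"
  by (rule retract_sretract[of "Ident E X" X X "Ident E X"]) (simp_all add: Mor_def)

text \<open>The identity of \<open>P\<close> factors through \<open>P\<close>, so zero maps serve as
  \<open>u\<close> and \<open>v\<close>: a projective is zero in the stable category.\<close>

lemma Proj_sretract:
  assumes "P \<in> Proj E" "Y \<in> Obj E" shows "sretract P Y"
proof -
  have P: "P \<in> Obj E" using assms(1) by (rule Proj_Obj)
  have "Ident E P \<in> proj_ideal E P P"
    using proj_idealI[OF assms(1), of "Ident E P" P "Ident E P" P] P by (simp add: Mor_def)
  moreover have "Ident E P = Zero E Y P \<cdot> Zero E P Y \<oplus> Ident E P" using P assms(2) by simp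
  ultimately show ?thesis unfolding sretract_def using Zero_Mor P assms(2) by blast
qed

lemma sretract_trans:
  assumes "sretract X Y" "sretract Y Z" shows "sretract X Z"
proof -
  obtain u v e where 1: "u \<in> Mor E X Y" "v \<in> Mor E Y X" "e \<in> proj_ideal E X X" "Ident E X = v \<cdot> u \<oplus> e"
    using assms(1) unfolding sretract_def by blast
  obtain u' v' e' where 2: "u' \<in> Mor E Y Z" "v' \<in> Mor E Z Y" "e' \<in> proj_ideal E Y Y" "Ident E Y = v' \<cdot> u' \<oplus> e'"
    using assms(2) unfolding sretract_def by blast
  note mor = 1(1,2) 2(1,2) proj_ideal_Mor[OF 1(3)] proj_ideal_Mor[OF 2(3)]
  have "v \<cdot> u = v \<cdot> ((v' \<cdot> u' \<oplus> e') \<cdot> u)" unfolding 2(4)[symmetric] using mor by (simp add: Mor_def)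
  also have "\<dots> = (v \<cdot> v') \<cdot> (u' \<cdot> u) \<oplus> v \<cdot> (e' \<cdot> u)"
    using mor by (simp add: Mor_def distrib_left distrib_right assoc)
  finally have "Ident E X = ((v \<cdot> v') \<cdot> (u' \<cdot> u) \<oplus> v \<cdot> (e' \<cdot> u)) \<oplus> e" using 1(4) by simp
  also have "\<dots> = (v \<cdot> v') \<cdot> (u' \<cdot> u) \<oplus> (v \<cdot> (e' \<cdot> u) \<oplus> e)"
    using mor by (intro Add_assoc) (simp_all add: Mor_def)
  finally have "Ident E X = (v \<cdot> v') \<cdot> (u' \<cdot> u) \<oplus> (v \<cdot> (e' \<cdot> u) \<oplus> e)" .
  moreover have "v \<cdot> (e' \<cdot> u) \<oplus> e \<in> proj_ideal E X X"
    using proj_ideal_Add[OF proj_ideal_Cmp_left[OF proj_ideal_Cmp_right[OF 2(3) 1(1)] 1(2)] 1(3)] .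
  moreover have "v \<cdot> v' \<in> Mor E Z X" "u' \<cdot> u \<in> Mor E X Z" using mor by (simp_all add: Mor_def)
  ultimately show ?thesis unfolding sretract_def by blast
qed

text \<open>Comparison of presentations: projectivity of \<open>P\<close> lifts
  \<open>u \<cdot> p\<close> through \<open>q\<close>, and the lift restricts to the
  kernels.\<close>

lemma syz_map:
  assumes s: "ses i p S P X" and t: "ses j q T Q Y" and P: "P \<in> Proj E" and u: "u \<in> Mor E X Y"
  obtains u' u'' where "u' \<in> Mor E P Q" "u'' \<in> Mor E S T" "q \<cdot> u' = u \<cdot> p" "j \<cdot> u'' = u' \<cdot> i"
proof -
  note sD = sesD[OF s] and tD = sesD[OF t]
  have "u \<cdot> p \<in> Mor E P Y" using u sD(2) by (simp add: Mor_def)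
  then obtain u' where u': "u' \<in> Mor E P Q" "q \<cdot> u' = u \<cdot> p" using Proj_lift[OF P t] by blast
  have "q \<cdot> (u' \<cdot> i) = (q \<cdot> u') \<cdot> i" using u'(1) sD(1) tD(2) by (simp add: Mor_def assoc)
  also have "\<dots> = u \<cdot> (p \<cdot> i)" unfolding u'(2) using u sD(1,2) by (simp add: Mor_def assoc)
  also have "\<dots> = Zero E S Y" unfolding ses_comp_Zero[OF s] using u sD(6) by (auto simp: Mor_def)
  finally obtain u'' where "u'' \<in> Mor E S T" "j \<cdot> u'' = u' \<cdot> i"
    using ses_lift[OF t, of "u' \<cdot> i" S] u'(1) sD(1) by (auto simp: Mor_def)
  then show ?thesis using u' that by blast
qed

text \<open>This is the action of the syzygy functor on a stable retraction, carried out on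
  representatives and for arbitrary syzygies \<open>S\<close> and \<open>T\<close>.\<close>

lemma syz_sretract:
  assumes r: "sretract X Y" and "syz X S" "syz Y T"
  shows "sretract S T"
proof -
  obtain P i p where P: "P \<in> Proj E" and s: "ses i p S P X" using assms(2) unfolding syz_def by blast
  obtain P' j q where P': "P' \<in> Proj E" and t: "ses j q T P' Y" using assms(3) unfolding syz_def by blast
  note sD = sesD[OF s] and tD = sesD[OF t]
  obtain u v e where uv: "u \<in> Mor E X Y" "v \<in> Mor E Y X" "e \<in> proj_ideal E X X" "Ident E X = v \<cdot> u \<oplus> e"
    using r unfolding sretract_def by blast
  obtain a b Q where e: "Q \<in> Proj E" "a \<in> Mor E X Q" "b \<in> Mor E Q X" "e = b \<cdot> a"
    using proj_idealE[OF uv(3)] .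
  obtain u' u'' where u: "u' \<in> Mor E P P'" "u'' \<in> Mor E S T" "q \<cdot> u' = u \<cdot> p" "j \<cdot> u'' = u' \<cdot> i"
    using syz_map[OF s t P uv(1)] .
  obtain v' v'' where v: "v' \<in> Mor E P' P" "v'' \<in> Mor E T S" "p \<cdot> v' = v \<cdot> q" "i \<cdot> v'' = v' \<cdot> j"
    using syz_map[OF t s P' uv(2)] .
  obtain b' where b': "b' \<in> Mor E Q P" "p \<cdot> b' = b" using Proj_lift[OF e(1) s e(3)] .
  note mor = uv(1,2) e(2,3) u(1,2) v(1,2) b'(1) sD(1,2) tD(1,2)
  \<comment> \<open>Both \<open>?h\<close> and the identity of \<open>P\<close> are lifts of
    \<open>p\<close> along \<open>p\<close>, since the identity of \<open>X\<close> is
    \<open>v \<cdot> u \<oplus> b \<cdot> a\<close>. They differ by \<open>i \<cdot> h\<close>;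
    restricted to \<open>S\<close>, the term with \<open>a \<cdot> p\<close> dies and only
    \<open>h \<cdot> i\<close>, which factors through \<open>P\<close>, remains as the
    error.\<close>
  let ?h = "v' \<cdot> u' \<oplus> b' \<cdot> (a \<cdot> p)"
  have "p \<cdot> ?h = (p \<cdot> v') \<cdot> u' \<oplus> (p \<cdot> b') \<cdot> (a \<cdot> p)" using mor by (simp add: Mor_def distrib_left assoc)
  also have "(p \<cdot> v') \<cdot> u' = v \<cdot> (q \<cdot> u')" unfolding v(3) using mor by (simp add: Mor_def assoc)
  also have "v \<cdot> (q \<cdot> u') \<oplus> (p \<cdot> b') \<cdot> (a \<cdot> p) = (v \<cdot> u \<oplus> e) \<cdot> p"
    unfolding u(3) b'(2) e(4) using mor by (simp add: Mor_def assoc distrib_right)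
  also have "\<dots> = p \<cdot> Ident E P" unfolding uv(4)[symmetric] using mor sD(6-8) by (simp add: Mor_def)
  finally obtain h where h: "h \<in> Mor E P S" "Ident E P = ?h \<oplus> i \<cdot> h"
    using ses_difference[OF s, of "Ident E P" P ?h] mor sD(6-8) by (auto simp: Mor_def)
  have "i \<cdot> Ident E S = (?h \<oplus> i \<cdot> h) \<cdot> i" unfolding h(2)[symmetric] using mor sD(6-8) by (simp add: Mor_def)
  also have "\<dots> = (v' \<cdot> (u' \<cdot> i) \<oplus> b' \<cdot> (a \<cdot> (p \<cdot> i))) \<oplus> i \<cdot> (h \<cdot> i)"
    using mor h(1) by (simp add: Mor_def distrib_right assoc)
  also have "\<dots> = v' \<cdot> (u' \<cdot> i) \<oplus> i \<cdot> (h \<cdot> i)"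
    unfolding ses_comp_Zero[OF s] using mor h(1) sD(6-8) by (auto simp: Mor_def)
  also have "v' \<cdot> (u' \<cdot> i) = (v' \<cdot> j) \<cdot> u''" unfolding u(4)[symmetric] using mor by (simp add: Mor_def assoc)
  also have "\<dots> = i \<cdot> (v'' \<cdot> u'')" unfolding v(4)[symmetric] using mor by (simp add: Mor_def assoc)
  also have "i \<cdot> (v'' \<cdot> u'') \<oplus> i \<cdot> (h \<cdot> i) = i \<cdot> (v'' \<cdot> u'' \<oplus> h \<cdot> i)"
    using mor h(1) by (simp add: Mor_def distrib_left)
  finally have "Ident E S = v'' \<cdot> u'' \<oplus> h \<cdot> i"
    using ses_mono[OF s, of "Ident E S" "v'' \<cdot> u'' \<oplus> h \<cdot> i" S] mor h(1) sD(6-8) by (simp add: Mor_def)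
  then show ?thesis unfolding sretract_def using mor proj_idealI[OF P sD(1) h(1)] by blast
qed

lemma nsyz_sretract:
  assumes "sretract X Y" "(syz ^^ n) X S" "(syz ^^ n) Y T"
  shows "sretract S T"
  using assms(2,3)
proof (induction n arbitrary: S T)
  case 0
  then show ?case using assms(1) by simp
next
  case (Suc n)
  then obtain S' T' where "(syz ^^ n) X S'" "syz S' S" "(syz ^^ n) Y T'" "syz T' T"
    by (auto elim!: relpowp_Suc_E)
  then show ?case using Suc.IH syz_sretract by blast
qed

text \<open>A stable retract of \<open>Y\<close> is a retract of \<open>Y \<oplus> P\<close> with \<open>P\<close> projective, here realised as a
  pullback over a zero object.\<close>

lemma sretract_retract:
  assumes "sretract X Y"
  obtains P W i q m r where "P \<in> Proj E" "ses i q Y W P" "m \<in> Mor E X W" "r \<in> Mor E W X"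
    "r \<cdot> m = Ident E X"
proof -
  obtain u v e where uv: "u \<in> Mor E X Y" "v \<in> Mor E Y X" "e \<in> proj_ideal E X X" "Ident E X = v \<cdot> u \<oplus> e"
    using assms unfolding sretract_def by blast
  obtain a b P where e: "P \<in> Proj E" "a \<in> Mor E X P" "b \<in> Mor E P X" "e = b \<cdot> a"
    using proj_idealE[OF uv(3)] .
  have obj: "X \<in> Obj E" "Y \<in> Obj E" "P \<in> Obj E" using uv e Mor_Obj by blast+
  \<comment> \<open>The zero object arises as the cokernel \<open>Z\<close> of the identity of
    \<open>Y\<close>. Since \<open>p\<close> is zero, every pair of maps to \<open>Y\<close> and
    \<open>P\<close> lifts to \<open>W\<close>.\<close>
  obtain p where "(Ident E Y, p) \<in> Confl E" using inflation_Ident[OF obj(2)] unfolding inflation_def by blast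
  from Confl_ses[OF this] obtain Z where s: "ses (Ident E Y) p Y Y Z" using obj by auto
  note sD = sesD[OF s]
  have p0: "p = Zero E Y Z" using ses_comp_Zero[OF s] sD(2) by (simp add: Mor_def)
  have z: "Zero E P Z \<in> Mor E P Z" using obj sD by (intro Zero_Mor) auto
  obtain q f W where pb: "pb p (Zero E P Z) q f Y P Z W" using pb_exists[OF sD(5,2) z] .
  note D = pbD[OF pb]
  obtain i where i: "ses i q Y W P" using pb_ses[OF pb s] .
  have "p \<cdot> u = Zero E P Z \<cdot> a" unfolding p0 using uv e(2) sD(8) by (auto simp: Mor_def)
  then obtain m where m: "m \<in> Mor E X W" "f \<cdot> m = u" "q \<cdot> m = a" using pb_lift[OF pb uv(1) e(2)] by blast
  let ?r = "v \<cdot> f \<oplus> b \<cdot> q"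
  have r: "?r \<in> Mor E W X" using uv(2) e(3) D(3,4) by (simp add: Mor_def)
  have "?r \<cdot> m = v \<cdot> (f \<cdot> m) \<oplus> b \<cdot> (q \<cdot> m)"
    using uv(2) e(3) D(3,4) m(1) by (simp add: Mor_def distrib_right assoc)
  also have "\<dots> = Ident E X" unfolding m uv(4) e(4) ..
  finally show ?thesis using that e(1) i m(1) r by blast
qed

text \<open>The complement of \<open>X\<close> is obtained by splitting the idempotent
  \<open>?e\<close>, the identity minus \<open>m \<cdot> r\<close>.\<close>

lemma retract_direct_summand:
  assumes ic: "idempotent_complete E" and m: "m \<in> Mor E X W" and r: "r \<in> Mor E W X"
    and rm: "r \<cdot> m = Ident E X"
  shows "direct_summand E X W"
proof -
  have obj: "X \<in> Obj E" "W \<in> Obj E" using m Mor_Obj by blast+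
  let ?e = "Ident E W \<oplus> neg m \<cdot> r"
  have e: "?e \<in> Mor E W W" using m r obj by (simp add: Mor_def)
  have "r \<cdot> ?e = r \<oplus> (r \<cdot> neg m) \<cdot> r"
    using m r obj by (simp add: Mor_def distrib_left assoc)
  also have "\<dots> = r \<oplus> neg r" using m r obj rm by (simp add: Mor_def Cmp_neg)
  finally have re: "r \<cdot> ?e = Zero E W X" using r by (simp add: Mor_def)
  have "?e \<cdot> m = m \<oplus> neg m \<cdot> (r \<cdot> m)" using m r obj by (simp add: Mor_def distrib_right assoc)
  then have em: "?e \<cdot> m = Zero E X W" unfolding rm using m obj by (simp add: Mor_def)
  have "?e \<cdot> ?e = Ident E W \<cdot> ?e \<oplus> (neg m \<cdot> r) \<cdot> ?e"
    using m r obj e by (intro distrib_right) (simp_all add: Mor_def)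
  also have "\<dots> = ?e \<oplus> neg m \<cdot> (r \<cdot> ?e)" using m r obj e by (simp add: Mor_def assoc)
  also have "\<dots> = ?e" unfolding re using m r obj e by (auto simp: Mor_def)
  finally obtain Y \<rho> s where Y: "Y \<in> Obj E" "\<rho> \<in> Mor E W Y" "s \<in> Mor E Y W" "s \<cdot> \<rho> = ?e" "\<rho> \<cdot> s = Ident E Y"
    using ic obj e unfolding idempotent_complete_def by blast
  have "r \<cdot> s = (r \<cdot> (s \<cdot> \<rho>)) \<cdot> s" using r Y(1-3,5) by (simp add: Mor_def assoc)
  then have rs: "r \<cdot> s = Zero E Y X" unfolding Y(4) re using Y(3) obj by (simp add: Mor_def)
  have "\<rho> \<cdot> m = (\<rho> \<cdot> s) \<cdot> (\<rho> \<cdot> m)" using m Y(1-3,5) by (simp add: Mor_def)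
  also have "\<dots> = \<rho> \<cdot> ((s \<cdot> \<rho>) \<cdot> m)" using m Y(1-3) by (simp add: Mor_def assoc)
  finally have \<rho>m: "\<rho> \<cdot> m = Zero E X Y" unfolding Y(4) em using Y(2) obj by (simp add: Mor_def)
  have "m \<cdot> r \<oplus> s \<cdot> \<rho> = Ident E W \<oplus> (m \<cdot> r \<oplus> neg m \<cdot> r)"
    unfolding Y(4) using m r obj by (intro Add_left_commute) (simp_all add: Mor_def)
  also have "\<dots> = Ident E W" using m r obj by (simp add: Mor_def Cmp_neg)
  finally have "is_biproduct E W X Y"
    unfolding is_biproduct_def using m r rm rs \<rho>m Y by blast
  then show ?thesis unfolding direct_summand_def using obj Y by blast
qed

text \<open>\<open>X\<close> is a direct summand of an extension \<open>W\<close> of a projective by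
  \<open>Y\<close>; closure under extensions and then under summands applies.\<close>

lemma resolving_sretract:
  assumes ic: "idempotent_complete E" and res: "resolving E S" and "sretract X Y" "Y \<in> S"
  shows "X \<in> S"
proof -
  obtain P W i q m r where 1: "P \<in> Proj E" "ses i q Y W P" "m \<in> Mor E X W" "r \<in> Mor E W X"
    "r \<cdot> m = Ident E X" using sretract_retract[OF assms(3)] .
  have "P \<in> S" using res 1(1) unfolding resolving_def by blast
  then have "W \<in> S" using res 1(2) assms(4) unfolding resolving_def ses_def by (fastforce simp: Mor_def)
  then show ?thesis using retract_direct_summand[OF ic 1(3-5)] res unfolding resolving_def by blast
qed

end

section \<open>Spliced sequences and the two invariants\<close>

text \<open>In \<open>enat\<close> a bound by \<open>m\<close> is a strict bound by
  \<open>Suc m\<close>, and strict upper bounds on an infimum are witnessed by an element of the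
  set.\<close>

lemma enat_Inf_le_iff: "Inf A \<le> enat m \<longleftrightarrow> (\<exists>n\<le>m. enat n \<in> A)"
proof -
  have *: "x \<le> enat m \<longleftrightarrow> x < enat (Suc m)" for x by (cases x) auto
  have "Inf A \<le> enat m \<longleftrightarrow> (\<exists>x\<in>A. x \<le> enat m)" unfolding * by (rule Inf_less_iff)
  also have "\<dots> \<longleftrightarrow> (\<exists>n\<le>m. enat n \<in> A)" by (metis enat_ile enat_ord_simps(1))
  finally show ?thesis .
qed

lemma dell_le_iff:
  "dell E \<Omega> k X \<le> enat m \<longleftrightarrow>
     (\<exists>n\<le>m. \<exists>Y \<in> Obj E. stable_retract E ((\<Omega> ^^ n) X) ((\<Omega> ^^ (n + k)) Y))"
  unfolding dell_def enat_Inf_le_iff by auto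

text \<open>The bound \<open>m\<close> can itself be used in the conditions: a witness for a smaller
  \<open>m'\<close> also serves \<open>m\<close>, as \<open>m' - i\<close> grows to
  \<open>m - i\<close>.\<close>

lemma ddell_le_iff:
  "ddell E \<Omega> k X \<le> enat m \<longleftrightarrow>
     (\<exists>t\<le>m. \<exists>C d. admissibly_exact E X t C d \<and> (\<forall>i\<le>t. dell E \<Omega> (i + k) (C i) \<le> enat (m - i)))"
proof
  assume "ddell E \<Omega> k X \<le> enat m"
  then obtain m' t C d where "m' \<le> m" "t \<le> m'" "admissibly_exact E X t C d"
    "\<forall>i\<le>t. dell E \<Omega> (i + k) (C i) \<le> enat (m' - i)"
    unfolding ddell_def enat_Inf_le_iff by auto
  moreover have "enat (m' - i) \<le> enat (m - i)" for i using \<open>m' \<le> m\<close> by simp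
  ultimately show "\<exists>t\<le>m. \<exists>C d. admissibly_exact E X t C d \<and>
      (\<forall>i\<le>t. dell E \<Omega> (i + k) (C i) \<le> enat (m - i))"
    by (meson order_trans)
qed (auto simp: ddell_def enat_Inf_le_iff)

section \<open>Recursive form of spliced sequences\<close>

text \<open>Only the terms are kept, in a form suited to induction on the length. For length zero an
  equality replaces the isomorphism.\<close>

primrec spliced :: "('o, 'm, 'z) exact_data_scheme \<Rightarrow> nat \<Rightarrow> 'o \<Rightarrow> (nat \<Rightarrow> 'o) \<Rightarrow> bool" where
  "spliced E 0 X C \<longleftrightarrow> X = C 0"
| "spliced E (Suc t) X C \<longleftrightarrow> (\<exists>Z j q. j \<in> Mor E Z (C 0) \<and> q \<in> Mor E (C 0) X \<and> (j, q) \<in> Confl E \<and>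
     spliced E t Z (\<lambda>i. C (Suc i)))"

lemma spliced_iff:
  "spliced E t X C \<longleftrightarrow> (\<exists>Z j q. Z 0 = X \<and> Z t = C t \<and>
     (\<forall>i<t. j i \<in> Mor E (Z (Suc i)) (C i) \<and> q i \<in> Mor E (C i) (Z i) \<and> (j i, q i) \<in> Confl E))"
proof (induction t arbitrary: X C)
  case 0
  then show ?case by auto
next
  case (Suc t)
  show ?case
  proof
    assume "spliced E (Suc t) X C"
    then obtain Z0 j0 q0 where 0: "j0 \<in> Mor E Z0 (C 0)" "q0 \<in> Mor E (C 0) X" "(j0, q0) \<in> Confl E"
      "spliced E t Z0 (\<lambda>i. C (Suc i))" by auto
    from 0(4)[unfolded Suc.IH] obtain Z j q where Z: "Z 0 = Z0" "Z t = C (Suc t)"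
      "\<forall>i<t. j i \<in> Mor E (Z (Suc i)) (C (Suc i)) \<and> q i \<in> Mor E (C (Suc i)) (Z i) \<and> (j i, q i) \<in> Confl E"
      by blast
    show "\<exists>Z j q. Z 0 = X \<and> Z (Suc t) = C (Suc t) \<and>
      (\<forall>i<Suc t. j i \<in> Mor E (Z (Suc i)) (C i) \<and> q i \<in> Mor E (C i) (Z i) \<and> (j i, q i) \<in> Confl E)"
      using 0(1-3) Z
      by (intro exI[of _ "case_nat X Z"] exI[of _ "case_nat j0 j"] exI[of _ "case_nat q0 q"])
        (auto split: nat.split)
  next
    assume "\<exists>Z j q. Z 0 = X \<and> Z (Suc t) = C (Suc t) \<and>
      (\<forall>i<Suc t. j i \<in> Mor E (Z (Suc i)) (C i) \<and> q i \<in> Mor E (C i) (Z i) \<and> (j i, q i) \<in> Confl E)"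
    then obtain Z j q where Z: "Z 0 = X" "Z (Suc t) = C (Suc t)"
      "\<And>i. i < Suc t \<Longrightarrow> j i \<in> Mor E (Z (Suc i)) (C i) \<and> q i \<in> Mor E (C i) (Z i) \<and> (j i, q i) \<in> Confl E"
      by blast
    have "spliced E t (Z 1) (\<lambda>i. C (Suc i))"
      unfolding Suc.IH using Z
      by (intro exI[of _ "\<lambda>i. Z (Suc i)"] exI[of _ "\<lambda>i. j (Suc i)"] exI[of _ "\<lambda>i. q (Suc i)"]) auto
    then show "spliced E (Suc t) X C" using Z(3)[of 0] Z(1) by auto
  qed
qed

lemma admissibly_exact_spliced:
  assumes "admissibly_exact E X t C d" "0 < t" shows "spliced E t X C"
  using assms unfolding admissibly_exact_def spliced_iff by auto

text \<open>The differentials are rebuilt from the splicing maps; for length zero the identity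
  serves as \<open>d 0\<close>. The facts about the identity are assumptions so that the lemma
  applies to bare data such as the restricted structure.\<close>

lemma spliced_admissibly_exact:
  assumes "spliced E t X C" "Ident E X \<in> Mor E X X" "isomorphism E (Ident E X)"
  shows "\<exists>d. admissibly_exact E X t C d"
proof (cases t)
  case 0
  then show ?thesis using assms by (intro exI[of _ "\<lambda>_. Ident E X"]) (simp add: admissibly_exact_def)
next
  case (Suc n)
  obtain Z j q where Z: "Z 0 = X" "Z t = C t"
    "\<forall>i<t. j i \<in> Mor E (Z (Suc i)) (C i) \<and> q i \<in> Mor E (C i) (Z i) \<and> (j i, q i) \<in> Confl E"
    using assms(1) unfolding spliced_iff by blast
  define d where "d i = (if i = 0 then q 0 else if i < t then j (i - 1) \<cdot>\<^bsub>E\<^esub> q i else j (t - 1))" for i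
  have "admissibly_exact E X t C d"
    unfolding admissibly_exact_def Suc if_not_P[OF nat.distinct(2)]
    by (rule exI[of _ Z], rule exI[of _ j], rule exI[of _ q]) (use Z Suc in \<open>simp add: d_def\<close>)
  then show ?thesis by blast
qed

context exact_category
begin

section \<open>Iterated syzygies of objects and of sequences\<close>

lemma nsyz_Obj: "(syz ^^ n) X S \<Longrightarrow> X \<in> Obj E \<Longrightarrow> S \<in> Obj E"
  by (cases n) (auto elim!: relpowp_Suc_E dest: syz_Obj)

lemma nsyz_add: "(syz ^^ m) X Y \<Longrightarrow> (syz ^^ n) Y Z \<Longrightarrow> (syz ^^ (m + n)) X Z"
  by (auto simp: relpowp_add)

lemma syzygy_choice_nsyz:
  assumes "syzygy_choice E \<Omega>" "X \<in> Obj E" shows "(syz ^^ n) X ((\<Omega> ^^ n) X)"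
proof (induction n)
  case (Suc n)
  have "(\<Omega> ^^ n) X \<in> Obj E" using nsyz_Obj Suc assms(2) by blast
  then have "syz ((\<Omega> ^^ n) X) (\<Omega> ((\<Omega> ^^ n) X))"
    using assms(1) unfolding syzygy_choice_def syz_def ses_def by blast
  then show ?case using Suc by auto
qed simp

text \<open>Syzygies preserve stable retracts, so the witness for \<open>Y\<close> also serves
  \<open>X\<close>. In particular the invariant can be moved along an isomorphism.\<close>

lemma dell_sretract:
  assumes \<Omega>: "syzygy_choice E \<Omega>" and "sretract X Y" "dell E \<Omega> k Y \<le> enat m"
  shows "dell E \<Omega> k X \<le> enat m"
proof -
  obtain n Z where "n \<le> m" "Z \<in> Obj E" "sretract ((\<Omega> ^^ n) Y) ((\<Omega> ^^ (n + k)) Z)"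
    using assms(3) unfolding dell_le_iff stable_retract_iff by blast
  moreover have "sretract ((\<Omega> ^^ n) X) ((\<Omega> ^^ n) Y)" for n
    using nsyz_sretract[OF assms(2)] syzygy_choice_nsyz[OF \<Omega>] sretract_Obj[OF assms(2)] by blast
  ultimately show ?thesis unfolding dell_le_iff stable_retract_iff using sretract_trans by blast
qed

text \<open>The horseshoe applied to the first conflation returns a syzygy \<open>Z'\<close> of the
  kernel \<open>Z\<close>, which is exactly the input for the rest of the sequence.\<close>

lemma spliced_horseshoe:
  assumes enough: "enough_projectives E" and "spliced E t X C" "syz X S"
  shows "\<exists>D. spliced E t S D \<and> (\<forall>i\<le>t. syz (C i) (D i))"
  using assms(2,3)
proof (induction t arbitrary: X C S)
  case 0
  then show ?case by (intro exI[of _ "\<lambda>_. S"]) simp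
next
  case (Suc t)
  then obtain Z j q where s: "ses j q Z (C 0) X" and sp: "spliced E t Z (\<lambda>i. C (Suc i))"
    by (auto simp: ses_def)
  obtain j' q' Z' D0 where D0: "ses j' q' Z' D0 S" "syz (C 0) D0" "syz Z Z'"
    using horseshoe[OF enough s Suc.prems(2)] .
  obtain D where D: "spliced E t Z' D" "\<forall>i\<le>t. syz (C (Suc i)) (D i)"
    using Suc.IH[OF sp D0(3)] by blast
  show ?case
  proof (intro exI conjI)
    show "spliced E (Suc t) S (case_nat D0 D)" using D0(1) D(1) by (auto simp: ses_def)
    show "\<forall>i\<le>Suc t. syz (C i) (case_nat D0 D i)" using D0(2) D(2) by (auto split: nat.split)
  qed
qed

lemma spliced_nsyz:
  assumes enough: "enough_projectives E" and "spliced E t X C" "(syz ^^ n) X S"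
  shows "\<exists>D. spliced E t S D \<and> (\<forall>i\<le>t. (syz ^^ n) (C i) (D i))"
  using assms(3)
proof (induction n arbitrary: S)
  case 0
  then show ?case using assms(2) by auto
next
  case (Suc n)
  then obtain T where T: "(syz ^^ n) X T" "syz T S" by (auto elim!: relpowp_Suc_E)
  obtain D where D: "spliced E t T D" "\<forall>i\<le>t. (syz ^^ n) (C i) (D i)" using Suc.IH[OF T(1)] by blast
  obtain D' where "spliced E t S D'" "\<forall>i\<le>t. syz (D i) (D' i)"
    using spliced_horseshoe[OF enough D(1) T(2)] by blast
  then show ?case using D(2) by auto
qed

text \<open>The \<open>n\<close> syzygy conflations leading from \<open>X\<close> to
  \<open>S\<close> are spliced in front, which shifts the old terms by \<open>n\<close>
  places.\<close>

lemma nsyz_spliced: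
  assumes "(syz ^^ n) X S" "spliced E t S D"
  shows "\<exists>C. spliced E (n + t) X C \<and> (\<forall>i<n. C i \<in> Proj E) \<and> (\<forall>i\<le>t. C (n + i) = D i)"
  using assms(1)
proof (induction n arbitrary: X)
  case 0
  then show ?case using assms(2) by auto
next
  case (Suc n)
  then obtain T where T: "syz X T" "(syz ^^ n) T S" using relpowp_Suc_D2 by metis
  obtain P i p where P: "P \<in> Proj E" "ses i p T P X" using T(1) unfolding syz_def by blast
  obtain C where C: "spliced E (n + t) T C" "\<forall>i<n. C i \<in> Proj E" "\<forall>i\<le>t. C (n + i) = D i"
    using Suc.IH[OF T(2)] by blast
  show ?case
  proof (intro exI conjI)
    show "spliced E (Suc n + t) X (case_nat P C)" using P(2) C(1) by (auto simp: ses_def)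
    show "\<forall>i<Suc n. case_nat P C i \<in> Proj E" using P(1) C(2) by (auto split: nat.split)
    show "\<forall>i\<le>t. case_nat P C (Suc n + i) = D i" using C(3) by auto
  qed
qed

end

section \<open>Resolving subcategories\<close>

locale resolving_subcategory = exact_category E
  for E :: "('o, 'm, 'z) exact_data_scheme" (structure) +
  fixes S :: "'o set"
  assumes idempotent_complete: "idempotent_complete E"
    and enough_projectives: "enough_projectives E"
    and resolving: "resolving E S"
    and Proj_sub: "Proj (full_subcategory E S) = Proj E"
begin

abbreviation Sub :: "('o, 'm, 'z) exact_data_scheme" where
  "Sub \<equiv> full_subcategory E S"

lemma S_Obj: "X \<in> S \<Longrightarrow> X \<in> Obj E"
  using resolving unfolding resolving_def by blast

lemma Proj_S: "P \<in> Proj E \<Longrightarrow> P \<in> S"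
  using resolving unfolding resolving_def by blast

lemma sub_simps [simp]:
  "Obj Sub = S" "Dom Sub = Dom E" "Cod Sub = Cod E" "Ident Sub = Ident E" "Cmp Sub = Cmp E"
  "Add Sub = Add E" "Zero Sub = Zero E"
  by (simp_all add: full_subcategory_def)

lemma Arr_sub: "Arr Sub = {f \<in> Arr E. Dom E f \<in> S \<and> Cod E f \<in> S}"
  by (simp add: full_subcategory_def)

lemma Confl_sub: "(i, p) \<in> Confl Sub \<longleftrightarrow> (i, p) \<in> Confl E \<and> Dom E i \<in> S \<and> Cod E i \<in> S \<and> Cod E p \<in> S"
  by (simp add: full_subcategory_def)

lemma Mor_sub: "f \<in> Mor Sub X Y \<longleftrightarrow> f \<in> Mor E X Y \<and> X \<in> S \<and> Y \<in> S"
  unfolding Mor_def by (auto simp: Arr_sub)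

section \<open>The stable category of the subcategory\<close>

text \<open>The subcategory is full and has the same projectives, all of them in \<open>S\<close>,
  so between objects of \<open>S\<close> the two ideals coincide.\<close>

lemma stable_rel_sub: "(f, g) \<in> stable_rel Sub \<longleftrightarrow> (f, g) \<in> stable_rel E \<and> f \<in> Arr Sub"
proof -
  have "proj_ideal Sub X Y = proj_ideal E X Y" "hom_group Sub X Y = hom_group E X Y"
    if "X \<in> S" "Y \<in> S" for X Y
    using that Proj_S
    by (auto simp: proj_ideal_def Proj_sub Mor_sub hom_group_def cong: conj_cong)
  then show ?thesis unfolding stable_rel_def by (auto simp: Mor_sub) (auto simp: Mor_def Arr_sub)
qed

lemma stable_rel_sub_image: "A \<subseteq> Arr Sub \<Longrightarrow> stable_rel Sub `` A = stable_rel E `` A"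
  unfolding Image_def using stable_rel_sub by blast

lemma Mor_stable_sub:
  assumes "X \<in> S" "Y \<in> S"
  shows "Mor (stable_category Sub) X Y = Mor (stable_category E) X Y"
proof -
  have "Arr Sub // stable_rel Sub = {stable_class f | f. f \<in> Arr Sub}"
    unfolding quotient_def using stable_rel_sub_image[of "{f}" for f] by blast
  then have *: "Mor (stable_category Sub) X Y = {U. (\<exists>f \<in> Arr Sub. U = stable_class f) \<and>
      the_elem (Dom E ` U) = X \<and> the_elem (Cod E ` U) = Y}"
    unfolding Mor_def[of "stable_category Sub"] by (auto simp: stable_category_def)
  have "((\<exists>f \<in> Arr Sub. U = stable_class f) \<and> the_elem (Dom E ` U) = X \<and> the_elem (Cod E ` U) = Y)
      \<longleftrightarrow> (\<exists>f \<in> Mor E X Y. U = stable_class f)" for U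
    using assms stable_class_Dom_Cod by (auto simp: Mor_def Arr_sub)
  then show ?thesis unfolding * Mor_stable_category by auto
qed

lemma stable_retract_sub:
  assumes "X \<in> S" "Y \<in> S"
  shows "stable_retract Sub X Y \<longleftrightarrow> sretract X Y"
proof -
  have "V \<cdot>\<^bsub>stable_category Sub\<^esub> U = V \<cdot>\<^bsub>stable_category E\<^esub> U"
    if UV: "U \<in> Mor (stable_category E) X Y" "V \<in> Mor (stable_category E) Y X" for U V
  proof -
    obtain u v where uv: "u \<in> Mor E X Y" "U = stable_class u" "v \<in> Mor E Y X" "V = stable_class v"
      using UV unfolding Mor_stable_category by blast
    have "f \<in> Mor E X Y" if "f \<in> U" for f
      using that uv(1,2) unfolding stable_rel_def by (auto simp: Mor_def)
    moreover have "g \<in> Mor E Y X" if "g \<in> V" for g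
      using that uv(3,4) unfolding stable_rel_def by (auto simp: Mor_def)
    ultimately have "{g \<cdot> f | g f. g \<in> V \<and> f \<in> U} \<subseteq> Arr Sub"
      using assms by (fastforce simp: Mor_def Arr_sub)
    then show ?thesis using stable_rel_sub_image by (simp add: stable_category_def)
  qed
  moreover have "Ident (stable_category Sub) X = Ident (stable_category E) X"
    using stable_rel_sub_image[of "{Ident E X}"] assms(1) S_Obj by (simp add: stable_category_def Arr_sub)
  ultimately have "stable_retract Sub X Y \<longleftrightarrow> stable_retract E X Y"
    unfolding stable_retract_def retract_def using Mor_stable_sub assms by auto
  then show ?thesis by (simp add: stable_retract_iff)
qed

text \<open>A syzygy conflation of \<open>Sub\<close> is one of \<open>E\<close> because the
  projectives agree. Membership in \<open>S\<close> is carried along since the choice is constrained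
  only on \<open>S\<close>.\<close>

lemma sub_choice_nsyz:
  assumes "syzygy_choice Sub \<Omega>" "X \<in> S"
  shows "(syz ^^ n) X ((\<Omega> ^^ n) X) \<and> (\<Omega> ^^ n) X \<in> S"
proof (induction n)
  case (Suc n)
  then obtain P i p where "P \<in> Proj E" "i \<in> Mor Sub (\<Omega> ((\<Omega> ^^ n) X)) P"
    "p \<in> Mor Sub P ((\<Omega> ^^ n) X)" "(i, p) \<in> Confl Sub"
    using assms(1) unfolding syzygy_choice_def Proj_sub by auto
  then have "syz ((\<Omega> ^^ n) X) (\<Omega> ((\<Omega> ^^ n) X))" "\<Omega> ((\<Omega> ^^ n) X) \<in> S"
    unfolding syz_def ses_def Mor_sub Confl_sub by blast+
  then show ?case using Suc by auto
qed (use assms in simp)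

text \<open>Apply syzygies to the trivial retraction of \<open>X\<close>. By symmetry any two
  \<open>n\<close>-th syzygies are stable retracts of each other, which replaces stable isomorphism
  throughout.\<close>

lemma nsyz_unique:
  assumes "X \<in> Obj E" "(syz ^^ n) X Y" "(syz ^^ n) X Y'"
  shows "sretract Y Y'"
  using nsyz_sretract[OF sretract_refl] assms by blast

section \<open>The lower bound\<close>

text \<open>The same \<open>n\<close> and \<open>Y\<close> work in \<open>E\<close>; the syzygies of
  the two choices are exchanged on both sides of the retraction.\<close>

lemma dell_le_dell_sub:
  assumes \<Omega>: "syzygy_choice E \<Omega>" and \<Omega>': "syzygy_choice Sub \<Omega>'"
    and C: "C \<in> S" and d: "dell Sub \<Omega>' k C \<le> enat m"
  shows "dell E \<Omega> k C \<le> enat m"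
proof -
  obtain n Y where n: "n \<le> m" "Y \<in> S" "stable_retract Sub ((\<Omega>' ^^ n) C) ((\<Omega>' ^^ (n + k)) Y)"
    using d unfolding dell_le_iff by auto
  then have "sretract ((\<Omega>' ^^ n) C) ((\<Omega>' ^^ (n + k)) Y)"
    using stable_retract_sub sub_choice_nsyz[OF \<Omega>'] C by blast
  moreover have "sretract ((\<Omega> ^^ n) C) ((\<Omega>' ^^ n) C)" "sretract ((\<Omega>' ^^ (n + k)) Y) ((\<Omega> ^^ (n + k)) Y)"
    using nsyz_unique sub_choice_nsyz[OF \<Omega>'] syzygy_choice_nsyz[OF \<Omega>] C n(2) S_Obj by blast+
  ultimately show ?thesis
    unfolding dell_le_iff stable_retract_iff using n S_Obj sretract_trans by blast
qed

lemma admissibly_exact_sub: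
  assumes "admissibly_exact Sub X t C d"
  shows "admissibly_exact E X t C d" "\<forall>i\<le>t. C i \<in> S"
proof -
  show "admissibly_exact E X t C d"
  proof (cases "t = 0")
    case True
    then have "d 0 \<in> Mor E (C 0) X" "isomorphism Sub (d 0)"
      using assms by (simp_all add: admissibly_exact_def Mor_sub)
    moreover have "isomorphism E (d 0)"
      using \<open>isomorphism Sub (d 0)\<close> unfolding isomorphism_def by (auto simp: Mor_sub Arr_sub)
    ultimately show ?thesis using True by (simp add: admissibly_exact_def)
  next
    case False
    then show ?thesis using assms unfolding admissibly_exact_def Mor_sub Confl_sub by auto
  qed
  show "\<forall>i\<le>t. C i \<in> S"
  proof (cases "t = 0")
    case True
    then show ?thesis using assms by (auto simp: admissibly_exact_def Mor_sub)
  next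
    case False
    then obtain Z j where Z: "Z t = C t" "\<forall>i<t. j i \<in> Mor Sub (Z (Suc i)) (C i)"
      using assms unfolding admissibly_exact_def by auto
    \<comment> \<open>The last term \<open>C t\<close> is not the middle of a conflation; its
      membership is read off from the last kernel map \<open>j (t - 1)\<close>.\<close>
    have "Z t \<in> S" using False Z(2)[rule_format, of "t - 1"] by (simp add: Mor_sub)
    then show ?thesis using Z by (metis Mor_sub le_neq_implies_less)
  qed
qed

lemma ddell_le_ddell_sub:
  assumes \<Omega>: "syzygy_choice E \<Omega>" and \<Omega>': "syzygy_choice Sub \<Omega>'"
  shows "ddell E \<Omega> k X \<le> ddell Sub \<Omega>' k X"
proof (cases "ddell Sub \<Omega>' k X")
  case (enat m)
  then have "ddell Sub \<Omega>' k X \<le> enat m" by simp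
  then obtain t C d where "t \<le> m" "admissibly_exact Sub X t C d"
    "\<forall>i\<le>t. dell Sub \<Omega>' (i + k) (C i) \<le> enat (m - i)"
    unfolding ddell_le_iff by blast
  then have "ddell E \<Omega> k X \<le> enat m"
    unfolding ddell_le_iff using admissibly_exact_sub dell_le_dell_sub[OF \<Omega> \<Omega>'] by meson
  then show ?thesis using enat by simp
qed simp

section \<open>The upper bound\<close>

text \<open>Closure under kernels of deflations puts each intermediate kernel \<open>Z\<close> into
  \<open>S\<close>, starting from \<open>X\<close>.\<close>

lemma spliced_sub:
  assumes "spliced E t X C" "X \<in> S" "\<forall>i\<le>t. C i \<in> S"
  shows "spliced Sub t X C"
  using assms
proof (induction t arbitrary: X C)
  case (Suc t)
  then obtain Z j q where Z: "j \<in> Mor E Z (C 0)" "q \<in> Mor E (C 0) X" "(j, q) \<in> Confl E"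
    "spliced E t Z (\<lambda>i. C (Suc i))" by auto
  have "C 0 \<in> S" using Suc.prems(3) by simp
  moreover have "Z \<in> S"
    using resolving Z(1-3) Suc.prems(2) \<open>C 0 \<in> S\<close> unfolding resolving_def by (fastforce simp: Mor_def)
  moreover have "spliced Sub t Z (\<lambda>i. C (Suc i))"
    using Suc.IH[OF Z(4) \<open>Z \<in> S\<close>] Suc.prems(3) by simp
  moreover have "(j, q) \<in> Confl Sub"
    using Z(1-3) \<open>C 0 \<in> S\<close> \<open>Z \<in> S\<close> Suc.prems(2) by (simp add: Confl_sub Mor_def)
  ultimately show ?case using Z(1,2) Suc.prems(2) by (auto simp: Mor_sub)
qed simp

text \<open>The hypothesis on \<open>c\<close> enters twice: it puts \<open>D\<close> into \<open>S\<close>, and it replaces the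
  object \<open>Y\<close> witnessing \<open>dell\<close> over \<open>E\<close> by \<open>\<Omega>\<^sup>c Y \<in> S\<close>.\<close>

lemma dell_sub_nsyz_le:
  assumes \<Omega>: "syzygy_choice E \<Omega>" and \<Omega>': "syzygy_choice Sub \<Omega>'"
    and c: "\<forall>M \<in> Obj E. (\<Omega> ^^ c) M \<in> S"
    and C: "C \<in> Obj E" and D: "(syz ^^ c) C D" and d: "dell E \<Omega> (k + c) C \<le> enat m"
  shows "D \<in> S" "dell Sub \<Omega>' (k + c) D \<le> enat m"
proof -
  note choice = syzygy_choice_nsyz[OF \<Omega>]
  have "sretract D ((\<Omega> ^^ c) C)" using nsyz_unique[OF C D] choice[OF C] by blast
  then show DS: "D \<in> S" using resolving_sretract[OF idempotent_complete resolving] c C by blast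
  obtain n Y where n: "n \<le> m" and Y: "Y \<in> Obj E"
    and r: "sretract ((\<Omega> ^^ n) C) ((\<Omega> ^^ (n + (k + c))) Y)"
    using d unfolding dell_le_iff stable_retract_iff by blast
  let ?n = "n + (k + c)"
  let ?Y = "(\<Omega> ^^ c) Y"
  have YS: "?Y \<in> S" using c Y by blast
  \<comment> \<open>Both sides of \<open>r\<close> are shifted by \<open>c\<close>. Then
    \<open>?A\<close> and \<open>(\<Omega>' ^^ n) D\<close> are both \<open>(n + c)\<close>-th
    syzygies of \<open>C\<close>, while \<open>?B\<close> and \<open>(\<Omega>' ^^ ?n) ?Y\<close>
    are both \<open>(?n + c)\<close>-th syzygies of \<open>Y\<close>.\<close>
  let ?A = "(\<Omega> ^^ c) ((\<Omega> ^^ n) C)" and ?B = "(\<Omega> ^^ c) ((\<Omega> ^^ ?n) Y)"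
  have obj: "(\<Omega> ^^ n) C \<in> Obj E" "(\<Omega> ^^ ?n) Y \<in> Obj E" using sretract_Obj[OF r] by auto
  have "sretract ?A ?B" using nsyz_sretract[OF r] choice obj by blast
  moreover have "sretract ((\<Omega>' ^^ n) D) ?A"
  proof (rule nsyz_unique[OF C])
    show "(syz ^^ (n + c)) C ((\<Omega>' ^^ n) D)"
      using nsyz_add[OF D] sub_choice_nsyz[OF \<Omega>' DS] by (metis add.commute)
    show "(syz ^^ (n + c)) C ?A" by (rule nsyz_add[OF choice[OF C] choice[OF obj(1)]])
  qed
  moreover have "sretract ?B ((\<Omega>' ^^ ?n) ?Y)"
  proof (rule nsyz_unique[OF Y])
    show "(syz ^^ (?n + c)) Y ((\<Omega>' ^^ ?n) ?Y)"
      using nsyz_add[OF choice[OF Y]] sub_choice_nsyz[OF \<Omega>' YS] by (metis add.commute)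
    show "(syz ^^ (?n + c)) Y ?B" by (rule nsyz_add[OF choice[OF Y] choice[OF obj(2)]])
  qed
  ultimately have "sretract ((\<Omega>' ^^ n) D) ((\<Omega>' ^^ ?n) ?Y)" using sretract_trans by blast
  then have "stable_retract Sub ((\<Omega>' ^^ n) D) ((\<Omega>' ^^ ?n) ?Y)"
    using stable_retract_sub sub_choice_nsyz[OF \<Omega>'] DS YS by blast
  then show "dell Sub \<Omega>' (k + c) D \<le> enat m"
    unfolding dell_le_iff using n YS by auto
qed

text \<open>Already \<open>n = 0\<close> works, with \<open>P\<close> itself as the object
  \<open>Y\<close>: a projective is a stable retract of every object.\<close>

lemma dell_sub_Proj:
  assumes \<Omega>': "syzygy_choice Sub \<Omega>'" and P: "P \<in> Proj E"
  shows "dell Sub \<Omega>' k P \<le> enat m"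
proof -
  have "P \<in> S" using Proj_S P .
  moreover from this have Y: "(\<Omega>' ^^ k) P \<in> S" using sub_choice_nsyz[OF \<Omega>'] by blast
  ultimately have "stable_retract Sub P ((\<Omega>' ^^ k) P)"
    using stable_retract_sub Proj_sretract[OF P S_Obj[OF Y]] by blast
  then show ?thesis unfolding dell_le_iff using \<open>P \<in> S\<close> by (intro exI[of _ 0]) auto
qed

lemma ddell_sub_le:
  assumes \<Omega>: "syzygy_choice E \<Omega>" and \<Omega>': "syzygy_choice Sub \<Omega>'"
    and c: "\<forall>M \<in> Obj E. (\<Omega> ^^ c) M \<in> S" and X: "X \<in> S"
  shows "ddell Sub \<Omega>' k X \<le> enat c + ddell E \<Omega> (k + c) X"
proof (cases "ddell E \<Omega> (k + c) X")
  case (enat m)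
  then have "ddell E \<Omega> (k + c) X \<le> enat m" by simp
  then obtain t C0 d where t: "t \<le> m" and adm: "admissibly_exact E X t C0 d"
    and C0: "\<And>i. i \<le> t \<Longrightarrow> dell E \<Omega> (i + (k + c)) (C0 i) \<le> enat (m - i)"
    unfolding ddell_le_iff by blast
  have XE: "X \<in> Obj E" using S_Obj[OF X] .
  \<comment> \<open>For \<open>t = 0\<close> the given \<open>C0 0\<close> is only isomorphic to
    \<open>X\<close>, whereas \<open>spliced\<close> demands equality; \<open>X\<close> takes its
    place and inherits the bound as a retract.\<close>
  have "\<exists>C. spliced E t X C \<and> (\<forall>i\<le>t. dell E \<Omega> (i + (k + c)) (C i) \<le> enat (m - i))"
  proof (cases "t = 0")
    case True
    then have f: "d 0 \<in> Mor E (C0 0) X" "isomorphism E (d 0)" using adm by (simp_all add: admissibly_exact_def)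
    then obtain g where "g \<in> Mor E X (C0 0)" "d 0 \<cdot> g = Ident E X"
      unfolding isomorphism_def by (auto simp: Mor_def)
    then have "sretract X (C0 0)" using retract_sretract f(1) by blast
    then have "dell E \<Omega> (k + c) X \<le> enat m" using dell_sretract[OF \<Omega>] C0[of 0] by simp
    then show ?thesis using True by (intro exI[of _ "\<lambda>_. X"]) simp
  next
    case False
    then show ?thesis using admissibly_exact_spliced[OF adm] C0 by blast
  qed
  then obtain C where C: "spliced E t X C"
    and dC: "\<And>i. i \<le> t \<Longrightarrow> dell E \<Omega> (i + (k + c)) (C i) \<le> enat (m - i)" by blast
  obtain D where D: "spliced E t ((\<Omega> ^^ c) X) D" "\<And>i. i \<le> t \<Longrightarrow> (syz ^^ c) (C i) (D i)"
    using spliced_nsyz[OF enough_projectives C syzygy_choice_nsyz[OF \<Omega> XE]] by blast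
  obtain B where B: "spliced E (c + t) X B" "\<And>i. i < c \<Longrightarrow> B i \<in> Proj E" "\<And>i. i \<le> t \<Longrightarrow> B (c + i) = D i"
    using nsyz_spliced[OF syzygy_choice_nsyz[OF \<Omega> XE] D(1)] by blast
  have CE: "C i \<in> Obj E" if "i \<le> t" for i
  proof (cases "t = 0")
    case True
    then show ?thesis using C XE that by simp
  next
    case False
    obtain Z j q where Z: "Z t = C t" "\<forall>i<t. j i \<in> Mor E (Z (Suc i)) (C i)"
      using C unfolding spliced_iff by blast
    have "Z t \<in> Obj E" using False Z(2)[rule_format, of "t - 1"] Mor_Obj by fastforce
    then show ?thesis using Z that by (metis Mor_Obj le_neq_implies_less)
  qed
  have *: "D i \<in> S \<and> dell Sub \<Omega>' (i + k + c) (D i) \<le> enat (m - i)" if "i \<le> t" for i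
    using dell_sub_nsyz_le[OF \<Omega> \<Omega>' c CE[OF that] D(2)[OF that], of "i + k" "m - i"] dC[OF that]
    by (simp add: add.assoc)
  have **: "B i \<in> S \<and> dell Sub \<Omega>' (i + k) (B i) \<le> enat (c + m - i)" if "i \<le> c + t" for i
  proof (cases "i < c")
    case True
    then show ?thesis using B(2) Proj_S dell_sub_Proj[OF \<Omega>'] by blast
  next
    case False
    \<comment> \<open>At position \<open>c + l\<close> the required index \<open>(c + l) + k\<close>
      equals \<open>(l + k) + c\<close>, and the allowance \<open>c + m - (c + l)\<close> equals
      \<open>m - l\<close>. This match with the bound for \<open>D l\<close> is the reason for the
      parameter \<open>k + c\<close>.\<close>
    then obtain l where l: "i = c + l" by (metis le_add_diff_inverse not_less)
    then show ?thesis using *[of l] B(3)[of l] that by (simp add: ac_simps)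
  qed
  have "spliced Sub (c + t) X B" using spliced_sub[OF B(1) X] ** by blast
  moreover have "Ident Sub X \<in> Mor Sub X X" using X XE by (simp add: Mor_sub Ident_Mor)
  moreover have "isomorphism Sub (Ident Sub X)"
    using X XE unfolding isomorphism_def by (auto simp: Mor_sub Arr_sub Ident_Mor intro!: bexI[of _ "Ident E X"])
  ultimately obtain d' where "admissibly_exact Sub X (c + t) B d'"
    using spliced_admissibly_exact[of Sub "c + t" X B] by metis
  moreover have "c + t \<le> c + m" using t by simp
  ultimately have "ddell Sub \<Omega>' k X \<le> enat (c + m)" unfolding ddell_le_iff using ** by blast
  then show ?thesis using enat by simp
qed simp

end

theorem theorem4p22:
  fixes \<A> :: "('o, 'm) exact_data"
    and \<X> :: "'o set"
    and \<Omega>\<^sub>A \<Omega>\<^sub>X :: "'o \<Rightarrow> 'o"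
    and c :: nat
  assumes "exact_category \<A>"
    and "idempotent_complete \<A>"
    and "enough_projectives \<A>"
    and "resolving \<A> \<X>"
    and "Proj (full_subcategory \<A> \<X>) = Proj \<A>"
    and "syzygy_choice \<A> \<Omega>\<^sub>A"
    and "syzygy_choice (full_subcategory \<A> \<X>) \<Omega>\<^sub>X"
    and "\<forall>M \<in> Obj \<A>. (\<Omega>\<^sub>A ^^ c) M \<in> \<X>"
  shows "\<forall>X \<in> \<X>. \<forall>k\<ge>1.
    ddell \<A> \<Omega>\<^sub>A k X \<le> ddell (full_subcategory \<A> \<X>) \<Omega>\<^sub>X k X \<and>
    ddell (full_subcategory \<A> \<X>) \<Omega>\<^sub>X k X \<le> enat c + ddell \<A> \<Omega>\<^sub>A (k + c) X"
proof -
  interpret resolving_subcategory \<A> \<X>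
    using assms(1-5) by (intro resolving_subcategory.intro resolving_subcategory_axioms.intro)
  show ?thesis using ddell_le_ddell_sub[OF assms(6,7)] ddell_sub_le[OF assms(6-8)] by blast
qed

end
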